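(* Let $1\leq p\leq\infty$. Let $\mathbb T$ be the $1$-torus and $\mathcal D=C^\infty(\mathbb T)$, let $P\in\mathbb C[X]$ be a polynomial in one variable, and let $T=P(d/dt)$ be the corresponding constant coefficient differential operator, viewed as an operator on $L^p(\mathbb T)$ with domain $\mathcal D$. Let $T_c$ be the maximal (distributional) extension of $T$ on $L^p(\mathbb T)$ (defined in the context), and let $T_e$ be a linear operator on $L^p(\mathbb T)$ with $T\subset T_e\subset T_c$. Then $T_e$ has the single-valued extension property. Let $f\in\mathcal D$, and let $\mathcal Ff:\mathbb Z\to\mathbb C$, $\mathcal Ff(n)=\frac1{2\pi}\int_0^{2\pi}f(t)e^{-int}\,dt$, be the Fourier transform of $f$. Then the following limit exists in the extended positive real numbers $[0,\infty]$ and $$\lim_{n\to\infty}\|T_e^nf\|_p^{1/n}=\sup\left\{|z| : z\in\{P(in) : n\in\mathbb Z,\ \mathcal Ff(n)\neq0\}^{\mathrm{cl}}\right\}.$$ Moreover, $$\sigma_{T_e}(f)=\{P(in) : n\in\mathbb Z,\ \mathcal Ff(n)\neq0\}^{\mathrm{cl}},$$ so that the former equality is a local spectral radius formula $\lim_{n\to\infty}\|T_e^nf\|_p^{1/n}=\sup\{|z| : z\in\sigma_{T_e}(f)\}$ for $T_e$ at $f$.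
   Context: Functions on $\mathbb T$ are identified with $2\pi$-periodic functions on $\mathbb R$, and $\mathbb T$ carries its rotation invariant measure of total mass $1$, i.e. $\frac1{2\pi}dt$ on $[0,2\pi]$. $T_c$ is the operator on $L^p(\mathbb T)$ whose domain consists of all $f\in L^p(\mathbb T)$ for which the distribution $P(d/dt)f$ is in $L^p(\mathbb T)$, i.e. for which there is $h\in L^p(\mathbb T)$ (necessarily unique) with $\frac1{2\pi}\int_0^{2\pi}h(t)g(t)\,dt=\frac1{2\pi}\int_0^{2\pi}f(t)\,(P(-d/dt)g)(t)\,dt$ for all $g\in C^\infty(\mathbb T)$; then $T_cf=h$. For operators, $A\subset B$ means that $B$ extends $A$. $A^{\mathrm{cl}}$ is the closure of $A\subset\mathbb C$; $\sup\emptyset=0$. For a linear operator $S$ on a complex Banach space $X$ with domain $\mathcal D(S)\subset X$: $S$ has the single-valued extension property if, for every non-empty open $U\subset\mathbb C$, the only analytic $\phi:U\to\mathcal D(S)$ with $(S-z)\phi_z=0$ for all $z\in U$ is zero. For $x\in X$, $z_0\in\mathbb C$ is in the local resolvent set $\rho_S(x)$ if there are an open neighborhood $U$ of $z_0$ and an analytic $\phi:U\to\mathcal D(S)$ with $(S-z)\phi_z=x$ for all $z\in U$; the local spectrum is $\sigma_S(x)=\mathbb C\setminus\rho_S(x)$. Analyticity is with respect to the norm of $X$ (an analytic $X$-valued function with values in $\mathcal D(S)$). *)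

theory Defs
  imports "HOL-Probability.Essential_Supremum" "HOL-Computational_Algebra.Polynomial"
begin

section \<open>Unbounded operators and local spectral theory\<close>

class complex_vector = ab_group_add +
  fixes scaleC :: "complex \<Rightarrow> 'a \<Rightarrow> 'a" (infixr "*\<^sub>C" 75)
  assumes scaleC_add_right: "a *\<^sub>C (x + y) = a *\<^sub>C x + a *\<^sub>C y"
    and scaleC_add_left: "(a + b) *\<^sub>C x = a *\<^sub>C x + b *\<^sub>C x"
    and scaleC_scaleC: "a *\<^sub>C b *\<^sub>C x = (a * b) *\<^sub>C x"
    and scaleC_one: "1 *\<^sub>C x = x"

global_interpretation complex_vector: vector_space "scaleC :: complex \<Rightarrow> 'a \<Rightarrow> 'a :: complex_vector"
  by unfold_locales (use scaleC_add_right scaleC_add_left scaleC_scaleC scaleC_one in auto)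

text \<open>
  An operator on a space \<open>X\<close> is a partial map \<open>S\<close> with domain \<open>dom S\<close>, and \<open>S \<subseteq>\<^sub>m S'\<close> says that
  \<open>S'\<close> extends \<open>S\<close>. A complex normed space is given by a subspace \<open>X\<close> of a complex vector space
  and a function \<open>N\<close> whose restriction to \<open>X\<close> is the norm.
\<close>

definition linear_operator :: "'a::complex_vector set \<Rightarrow> ('a \<rightharpoonup> 'a) \<Rightarrow> bool" where
  "linear_operator X S \<longleftrightarrow>
     dom S \<subseteq> X \<and> ran S \<subseteq> X \<and> complex_vector.subspace (dom S) \<and>
     (\<forall>x\<in>dom S. \<forall>y\<in>dom S. S (x + y) = Some (the (S x) + the (S y))) \<and>
     (\<forall>c. \<forall>x\<in>dom S. S (c *\<^sub>C x) = Some (c *\<^sub>C the (S x)))"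

text \<open>The power \<open>S\<^sup>n\<close>, with its natural domain.\<close>

definition op_power :: "('a \<rightharpoonup> 'a) \<Rightarrow> nat \<Rightarrow> ('a \<rightharpoonup> 'a)" where
  "op_power S n = (((\<circ>\<^sub>m) S) ^^ n) Some"

text \<open>Analyticity on an open set \<open>U\<close>: complex differentiability with respect to the norm.\<close>

definition analytic_into ::
  "'a::complex_vector set \<Rightarrow> ('a \<Rightarrow> real) \<Rightarrow> complex set \<Rightarrow> (complex \<Rightarrow> 'a) \<Rightarrow> bool" where
  "analytic_into X N U \<phi> \<longleftrightarrow>
     (\<forall>z\<in>U. \<phi> z \<in> X) \<and>
     (\<forall>z\<in>U. \<exists>d\<in>X. ((\<lambda>w. N (inverse (w - z) *\<^sub>C (\<phi> w - \<phi> z) - d)) \<longlongrightarrow> 0) (at z))"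

text \<open>\<open>resolvent_solution X N S x U \<phi>\<close>: the function \<open>\<phi> : U \<rightarrow> dom S\<close> is analytic and satisfies
  \<open>(S - z) \<phi>\<^sub>z = x\<close> for all \<open>z \<in> U\<close>.\<close>

definition resolvent_solution ::
  "'a::complex_vector set \<Rightarrow> ('a \<Rightarrow> real) \<Rightarrow> ('a \<rightharpoonup> 'a) \<Rightarrow> 'a \<Rightarrow> complex set \<Rightarrow> (complex \<Rightarrow> 'a) \<Rightarrow> bool"
  where
  "resolvent_solution X N S x U \<phi> \<longleftrightarrow>
     analytic_into X N U \<phi> \<and> (\<forall>z\<in>U. \<phi> z \<in> dom S \<and> the (S (\<phi> z)) - z *\<^sub>C \<phi> z = x)"

definition has_SVEP :: "'a::complex_vector set \<Rightarrow> ('a \<Rightarrow> real) \<Rightarrow> ('a \<rightharpoonup> 'a) \<Rightarrow> bool" where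
  "has_SVEP X N S \<longleftrightarrow>
     (\<forall>U \<phi>. open U \<and> U \<noteq> {} \<and> resolvent_solution X N S 0 U \<phi> \<longrightarrow> (\<forall>z\<in>U. \<phi> z = 0))"

definition local_resolvent_set ::
  "'a::complex_vector set \<Rightarrow> ('a \<Rightarrow> real) \<Rightarrow> ('a \<rightharpoonup> 'a) \<Rightarrow> 'a \<Rightarrow> complex set" where
  "local_resolvent_set X N S x =
     {z. \<exists>U \<phi>. open U \<and> z \<in> U \<and> resolvent_solution X N S x U \<phi>}"

definition local_spectrum ::
  "'a::complex_vector set \<Rightarrow> ('a \<Rightarrow> real) \<Rightarrow> ('a \<rightharpoonup> 'a) \<Rightarrow> 'a \<Rightarrow> complex set" where
  "local_spectrum X N S x = - local_resolvent_set X N S x"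


section \<open>Lebesgue spaces on the circle\<close>

definition circle_measure :: "real measure" where
  "circle_measure = uniform_measure lborel {0..2*pi}"

definition periodic :: "(real \<Rightarrow> complex) \<Rightarrow> bool" where
  "periodic f \<longleftrightarrow> (\<forall>t. f (t + 2*pi) = f t)"

definition circle_eq :: "(real \<Rightarrow> complex) \<Rightarrow> (real \<Rightarrow> complex) \<Rightarrow> bool" where
  "circle_eq f g \<longleftrightarrow>
     f \<in> borel_measurable borel \<and> periodic f \<and> g \<in> borel_measurable borel \<and> periodic g \<and>
     (AE t in circle_measure. f t = g t)"

text \<open>Classes of measurable functions on the circle modulo almost everywhere equality.\<close>

quotient_type circle_fun = "real \<Rightarrow> complex" / partial: circle_eq
proof (rule part_equivpI)
  show "\<exists>f. circle_eq f f"
    by (rule exI[of _ "\<lambda>_. 0"]) (simp add: circle_eq_def periodic_def)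
  show "symp circle_eq"
    by (rule sympI) (auto simp: circle_eq_def elim: eventually_mono)
  show "transp circle_eq"
    by (rule transpI) (auto simp: circle_eq_def elim: eventually_elim2)
qed

instantiation circle_fun :: complex_vector
begin

lift_definition zero_circle_fun :: circle_fun is "\<lambda>_. 0"
  by (simp add: circle_eq_def periodic_def)

lift_definition plus_circle_fun :: "circle_fun \<Rightarrow> circle_fun \<Rightarrow> circle_fun"
  is "\<lambda>f g t. f t + g t"
  by (auto simp: circle_eq_def periodic_def elim: eventually_elim2)

lift_definition uminus_circle_fun :: "circle_fun \<Rightarrow> circle_fun" is "\<lambda>f t. - f t"
  by (auto simp: circle_eq_def periodic_def elim: eventually_mono)

lift_definition minus_circle_fun :: "circle_fun \<Rightarrow> circle_fun \<Rightarrow> circle_fun"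
  is "\<lambda>f g t. f t - g t"
  by (auto simp: circle_eq_def periodic_def elim: eventually_elim2)

lift_definition scaleC_circle_fun :: "complex \<Rightarrow> circle_fun \<Rightarrow> circle_fun" is "\<lambda>c f t. c * f t"
  by (auto simp: circle_eq_def periodic_def elim: eventually_mono)

instance
  by standard (transfer; auto simp: circle_eq_def periodic_def algebra_simps)+

end

text \<open>
  The exponent \<open>p\<close> ranges over \<open>[1, \<infinity>]\<close>. The value of \<open>Lp_norm\<close> is meaningful on \<open>Lp p\<close> only.
  The expressions below do not depend on the chosen representative of the class.
\<close>

definition Lp :: "ereal \<Rightarrow> circle_fun set" where
  "Lp p = (if p = \<infinity>
     then {F. esssup circle_measure (\<lambda>t. ereal (norm (rep_circle_fun F t))) < \<infinity>}
     else {F. integrable circle_measure (\<lambda>t. norm (rep_circle_fun F t) powr real_of_ereal p)})"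

definition Lp_norm :: "ereal \<Rightarrow> circle_fun \<Rightarrow> real" where
  "Lp_norm p F = (if p = \<infinity>
     then real_of_ereal (esssup circle_measure (\<lambda>t. ereal (norm (rep_circle_fun F t))))
     else (LINT t|circle_measure. norm (rep_circle_fun F t) powr real_of_ereal p)
            powr (1 / real_of_ereal p))"


section \<open>Constant coefficient differential operators on the circle\<close>

abbreviation ddt :: "(real \<Rightarrow> complex) \<Rightarrow> real \<Rightarrow> complex" where
  "ddt f \<equiv> (\<lambda>t. vector_derivative f (at t))"

definition smooth_circle :: "(real \<Rightarrow> complex) set" where
  "smooth_circle = {f. periodic f \<and> (\<forall>n t. (ddt ^^ n) f differentiable (at t))}"

text \<open>\<open>poly_ddt P f\<close> is the function \<open>P(d/dt) f\<close>.\<close>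

definition poly_ddt :: "complex poly \<Rightarrow> (real \<Rightarrow> complex) \<Rightarrow> real \<Rightarrow> complex" where
  "poly_ddt P f = (\<lambda>t. \<Sum>k\<le>degree P. coeff P k * (ddt ^^ k) f t)"

text \<open>
  A smooth function is identified with its class \<open>abs_circle_fun f\<close>, which has no other smooth
  representative.
\<close>

definition T_op :: "complex poly \<Rightarrow> (circle_fun \<rightharpoonup> circle_fun)" where
  "T_op P F = (if F \<in> abs_circle_fun ` smooth_circle
     then Some (abs_circle_fun (poly_ddt P (THE f. f \<in> smooth_circle \<and> abs_circle_fun f = F)))
     else None)"

text \<open>
  \<open>distr_image P F H\<close>: the distribution \<open>P(d/dt) F\<close> is \<open>H\<close>. Here \<open>P \<circ>\<^sub>p [:0, -1:]\<close> is the
  polynomial \<open>P(-X)\<close>.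
\<close>

definition distr_image :: "complex poly \<Rightarrow> circle_fun \<Rightarrow> circle_fun \<Rightarrow> bool" where
  "distr_image P F H \<longleftrightarrow>
     (\<forall>g\<in>smooth_circle.
        (LINT t|circle_measure. rep_circle_fun H t * g t) =
        (LINT t|circle_measure. rep_circle_fun F t * poly_ddt (P \<circ>\<^sub>p [:0, -1:]) g t))"

definition Tc_op :: "ereal \<Rightarrow> complex poly \<Rightarrow> (circle_fun \<rightharpoonup> circle_fun)" where
  "Tc_op p P F = (if F \<in> Lp p \<and> (\<exists>H\<in>Lp p. distr_image P F H)
     then Some (THE H. H \<in> Lp p \<and> distr_image P F H)
     else None)"

definition fourier_coeff :: "(real \<Rightarrow> complex) \<Rightarrow> int \<Rightarrow> complex" where
  "fourier_coeff f n = (LINT t|circle_measure. f t * exp (- \<i> * of_int n * of_real t))"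

end

theory Submission
  imports Defs "HOL-Probability.Probability_Measure" "HOL-Analysis.Weierstrass_Theorems"
    "HOL-Library.Nat_Bijection"
begin

text \<open>
  The Fourier transform turns \<open>P(d/dt)\<close> into multiplication by the sequence \<open>P(in)\<close>, and the
  argument rests on two consequences of this for an extension \<open>Te\<close>. Testing the
  distributional equation with the characters \<open>e\<^sup>-\<^sup>i\<^sup>n\<^sup>t\<close> shows that the \<open>n\<close>-th Fourier coefficient of
  \<open>Te F\<close> is \<open>P(in)\<close> times that of \<open>F\<close>, for every \<open>F\<close> in the domain (\<open>Te_dom\<close>). On smooth functions,
  which are exactly the Fourier series with rapidly decreasing coefficients, \<open>Te\<close> multiplies the
  coefficients by \<open>P(in)\<close> (\<open>Te_trig_class\<close>). Single coefficients are controlled by the \<open>L\<^sup>p\<close> norm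
  (\<open>norm_fourier_coeff_le_Lp_norm\<close>), and the \<open>L\<^sup>p\<close> norm of a Fourier series is controlled by the sum
  of the moduli of its coefficients (\<open>Lp_norm_trig_class_le\<close>). Both estimates
  hold with constant \<open>1\<close> for every \<open>p\<close>.

  If \<open>(Te - z) \<phi>\<^sub>z = F\<close> then \<open>(P(in) - z) c\<^sub>n(\<phi>\<^sub>z) = c\<^sub>n(F)\<close>. For \<open>F = 0\<close> this kills all coefficients
  of \<open>\<phi>\<^sub>z\<close> at \<open>z \<noteq> P(in)\<close>, and at \<open>z = P(in)\<close> too because \<open>c\<^sub>n(\<phi>\<^sub>z)\<close> is continuous in \<open>z\<close>; an integrable
  function with vanishing coefficients is zero (\<open>fourier_coeff_unique\<close>), which is the single-valued extension property. For
  smooth \<open>F = f\<close> it shows that no \<open>z = P(in)\<close> with \<open>c\<^sub>n(f) \<noteq> 0\<close> lies in the local resolvent set.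
  Conversely, away from the closure of these points, \<open>\<phi>\<^sub>z = \<Sum> c\<^sub>n(f) / (P(in) - z) e\<^sup>i\<^sup>n\<^sup>t\<close> is a smooth
  solution that depends analytically on \<open>z\<close> (\<open>resolvent_series\<close>).

  The coefficients of \<open>Te\<^sup>k f\<close> are \<open>P(in)\<^sup>k c\<^sub>n(f)\<close>. With \<open>R\<close> the supremum of \<open>|P(in)|\<close> over the support
  of \<open>c(f)\<close>, the two norm estimates give \<open>|P(in)|\<^sup>k |c\<^sub>n(f)| \<le> \<parallel>Te\<^sup>k f\<parallel> \<le> R\<^sup>k \<Sum> |c\<^sub>m(f)|\<close>, and \<open>k\<close>-th
  roots converge to \<open>R\<close>.
\<close>

section \<open>Characters and the measure of the circle\<close>

lemma space_circle_measure [simp]: "space circle_measure = UNIV"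
  by (simp add: circle_measure_def)

lemma sets_circle_measure [simp, measurable_cong]: "sets circle_measure = sets borel"
  by (simp add: circle_measure_def)

lemma borel_measurable_circle_measure [simp]:
  "borel_measurable circle_measure = borel_measurable borel"
  by (rule measurable_cong_sets) simp_all

interpretation circle: prob_space circle_measure
  unfolding circle_measure_def by (rule prob_space_uniform_measure) auto

lemma AE_circle_measure:
  "(AE t in circle_measure. Q t) \<longleftrightarrow> (AE t in lborel. t \<in> {0..2*pi} \<longrightarrow> Q t)"
  unfolding circle_measure_def by (rule AE_uniform_measure) auto

lemma integral_circle_measure:
  fixes f :: "real \<Rightarrow> 'a::{banach, second_countable_topology}"
  assumes [measurable]: "f \<in> borel_measurable borel"
  shows "integral\<^sup>L circle_measure f = (1 / (2*pi)) *\<^sub>R (LINT t:{0..2*pi}|lborel. f t)"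
proof -
  have *: "circle_measure = density lborel (\<lambda>t. ennreal (indicator {0..2*pi} t / (2*pi)))"
    unfolding circle_measure_def uniform_measure_def
    by (rule density_cong) (auto simp: divide_ennreal indicator_def simp flip: ennreal_1)
  have "integral\<^sup>L circle_measure f
      = (LINT t|lborel. (1 / (2*pi)) *\<^sub>R (indicator {0..2*pi} t *\<^sub>R f t))"
    by (subst *, subst integral_density) auto
  then show ?thesis
    unfolding set_lebesgue_integral_def by (simp only: integral_scaleR_right)
qed

definition character :: "int \<Rightarrow> real \<Rightarrow> complex" where
  "character n t = cis (of_int n * t)"

lemma norm_character [simp]: "norm (character n t) = 1"
  by (simp add: character_def)

lemma character_0 [simp]: "character 0 t = 1"
  by (simp add: character_def)

lemma character_add: "character (m + n) t = character m t * character n t"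
  by (simp add: character_def cis_mult algebra_simps)

lemma character_measurable [measurable]: "character n \<in> borel_measurable borel"
  unfolding character_def by (intro borel_measurable_continuous_onI continuous_intros)

lemma fourier_coeff_eq: "fourier_coeff f n = (LINT t|circle_measure. f t * character (- n) t)"
  by (simp add: fourier_coeff_def character_def cis_conv_exp mult_ac)

lemma integrable_mult_bounded:
  fixes f g :: "real \<Rightarrow> complex"
  assumes "integrable circle_measure f" "g \<in> borel_measurable borel" "\<And>t. norm (g t) \<le> B"
  shows "integrable circle_measure (\<lambda>t. f t * g t)"
proof (rule Bochner_Integration.integrable_bound)
  show "integrable circle_measure (\<lambda>t. B * norm (f t))"
    using assms(1) by simp
  show "(\<lambda>t. f t * g t) \<in> borel_measurable circle_measure"
    using assms(1,2) borel_measurable_integrable[OF assms(1)] by measurable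
  have "norm (f t * g t) \<le> B * norm (f t)" for t
    using mult_right_mono[OF assms(3)[of t], of "norm (f t)"] by (simp add: norm_mult mult_ac)
  then show "AE t in circle_measure. norm (f t * g t) \<le> norm (B * norm (f t))"
    by (simp add: order.trans[OF _ abs_ge_self])
qed

lemma integrable_mult_character:
  "integrable circle_measure f \<Longrightarrow> integrable circle_measure (\<lambda>t. f t * character n t)"
  by (rule integrable_mult_bounded[where B = 1]) auto

section \<open>An integrable function is determined by its Fourier coefficients\<close>

text \<open>
  If all coefficients of \<open>f\<close> vanish, then \<open>f\<close> is orthogonal to the polynomials in \<open>Re\<close> and \<open>Im\<close> on the
  unit circle, hence by the Stone-Weierstrass theorem to the continuous functions, hence to the
  indicators of closed sets and finally of Borel sets.
\<close>

text \<open>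
  The functions that may be multiplied into every \<open>f\<close> with vanishing coefficients, keeping the
  coefficients zero, are closed under products. Quantifying over all \<open>f\<close>
  therefore makes the product case of the induction immediate; the linear case only shifts the
  index by \<open>\<plusminus>1\<close>.
\<close>

lemma fourier_coeff_vanish_mult_polynomial:
  assumes "real_polynomial_function q"
    and "integrable circle_measure f" and "\<And>n. fourier_coeff f n = 0"
  shows "integrable circle_measure (\<lambda>t. f t * of_real (q (cis t))) \<and>
         (\<forall>n. fourier_coeff (\<lambda>t. f t * of_real (q (cis t))) n = 0)"
  using assms
proof (induction arbitrary: f)
  case (linear q)
  interpret bounded_linear q by fact
  \<comment> \<open>on the circle \<open>q\<close> is \<open>a e\<^sup>i\<^sup>t + b e\<^sup>-\<^sup>i\<^sup>t\<close>\<close>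
  define a b where "a = (of_real (q 1) - \<i> * of_real (q \<i>)) / 2"
    and "b = (of_real (q 1) + \<i> * of_real (q \<i>)) / 2"
  have "q (cis t) = q (cos t *\<^sub>R 1 + sin t *\<^sub>R \<i>)" for t
    by (rule arg_cong[where f=q]) (simp add: complex_eq_iff)
  then have "q (cis t) = cos t * q 1 + sin t * q \<i>" for t
    by (simp add: add scaleR)
  then have "of_real (q (cis t)) = a * character 1 t + b * character (-1) t" for t
    by (simp add: a_def b_def character_def complex_eq_iff field_simps)
  then have *: "f t * of_real (q (cis t)) = a * (f t * character 1 t) + b * (f t * character (-1) t)" for t
    by (simp add: algebra_simps)
  note i = integrable_mult_character[OF linear.prems(1)]
  have "fourier_coeff (\<lambda>t. f t * of_real (q (cis t))) n
      = a * fourier_coeff f (n - 1) + b * fourier_coeff f (n + 1)" for n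
  proof -
    have "f t * of_real (q (cis t)) * character (- n) t
        = a * (f t * character (- (n - 1)) t) + b * (f t * character (- (n + 1)) t)" for t
      using character_add[of 1 "-n" t] character_add[of "-1" "-n" t]
      unfolding * by (simp add: algebra_simps)
    then show ?thesis
      unfolding fourier_coeff_eq using i by simp
  qed
  then show ?case unfolding * using i linear.prems(2) by auto
next
  case (const c)
  then show ?case by (simp add: fourier_coeff_def mult.assoc mult.left_commute[of _ "complex_of_real c"])
next
  case (add p q)
  let ?p = "\<lambda>t. f t * of_real (p (cis t))" and ?q = "\<lambda>t. f t * of_real (q (cis t))"
  note pq = add.IH(1)[OF add.prems] add.IH(2)[OF add.prems]
  have *: "f t * of_real (p (cis t) + q (cis t)) = ?p t + ?q t" for t
    by (simp add: distrib_left)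
  have "fourier_coeff (\<lambda>t. ?p t + ?q t) n = fourier_coeff ?p n + fourier_coeff ?q n" for n
    using pq unfolding fourier_coeff_eq distrib_right
    by (intro Bochner_Integration.integral_add integrable_mult_character) auto
  with pq show ?case unfolding * by auto
next
  case (mult p q)
  from mult.IH(1)[OF mult.prems] mult.IH(2)[of "\<lambda>t. f t * of_real (p (cis t))"]
  show ?case by (simp add: mult.assoc)
qed

lemma integral_vanish_mult_continuous:
  fixes h :: "complex \<Rightarrow> real"
  assumes f: "integrable circle_measure f" "\<And>n. fourier_coeff f n = 0"
    and h: "continuous_on UNIV h"
  shows "(LINT t|circle_measure. f t * of_real (h (cis t))) = 0"
proof -
  let ?I = "LINT t|circle_measure. norm (f t)"
  obtain B where B: "\<And>z. z \<in> sphere 0 1 \<Longrightarrow> norm (h z) \<le> B"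
    using compact_imp_bounded[OF compact_continuous_image[of "sphere 0 1" h]]
      continuous_on_subset[OF h] by (force simp: bounded_iff)
  have m: "(\<lambda>t. complex_of_real (h (cis t))) \<in> borel_measurable borel"
    by (intro borel_measurable_continuous_onI continuous_intros continuous_on_compose2[OF h]) auto
  have i: "integrable circle_measure (\<lambda>t. f t * of_real (h (cis t)))"
    by (rule integrable_mult_bounded[OF f(1) m, of B]) (use B in auto)
  have bound: "norm (LINT t|circle_measure. f t * of_real (h (cis t))) \<le> e * ?I" if "e > 0" for e
  proof -
    obtain q where q: "real_polynomial_function q" "\<And>z. z \<in> sphere 0 1 \<Longrightarrow> \<bar>h z - q z\<bar> < e"
      by (rule Stone_Weierstrass_real_polynomial_function
            [OF compact_sphere continuous_on_subset[OF h subset_UNIV] \<open>e > 0\<close>, of 0 1]) blast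
    note Q = fourier_coeff_vanish_mult_polynomial[OF q(1) f]
    have "(LINT t|circle_measure. f t * of_real (q (cis t))) = 0"
      using Q by (auto simp: fourier_coeff_eq dest: spec[of _ 0])
    then have "(LINT t|circle_measure. f t * of_real (h (cis t)))
      = (LINT t|circle_measure. f t * of_real (h (cis t)) - f t * of_real (q (cis t)))"
      using Q i by simp
    also have "norm \<dots> \<le> (LINT t|circle_measure. norm (f t * of_real (h (cis t)) - f t * of_real (q (cis t))))"
      by (rule integral_norm_bound)
    also have "\<dots> \<le> (LINT t|circle_measure. e * norm (f t))"
    proof (rule integral_mono)
      fix t
      have "norm (f t * of_real (h (cis t)) - f t * of_real (q (cis t)))
          = norm (f t) * \<bar>h (cis t) - q (cis t)\<bar>"
        by (metis norm_mult norm_of_real of_real_diff right_diff_distrib)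
      also have "\<dots> \<le> norm (f t) * e"
        using q(2)[of "cis t"] by (intro mult_left_mono) auto
      finally show "norm (f t * of_real (h (cis t)) - f t * of_real (q (cis t))) \<le> e * norm (f t)"
        by (simp add: mult.commute)
    qed (use i Q f in auto)
    finally show ?thesis by simp
  qed
  have pos: "0 < ?I + 1" by (simp add: add_nonneg_pos)
  have "norm (LINT t|circle_measure. f t * of_real (h (cis t))) \<le> 0"
  proof (rule field_le_epsilon)
    fix e :: real
    assume "e > 0"
    then have "norm (LINT t|circle_measure. f t * of_real (h (cis t))) \<le> (e / (?I + 1)) * ?I"
      by (intro bound divide_pos_pos pos)
    also have "\<dots> \<le> (e / (?I + 1)) * (?I + 1)"
      using \<open>e > 0\<close> pos by (intro mult_left_mono) auto
    also have "\<dots> = 0 + e"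
      using pos by simp
    finally show "norm (LINT t|circle_measure. f t * of_real (h (cis t))) \<le> 0 + e" .
  qed
  then show ?thesis by simp
qed

text \<open>
  The indicator of a closed set is the limit of the continuous functions \<open>max 0 (1 - k dist(z, B))\<close>.
\<close>

lemma set_integral_cis_vimage_closed:
  assumes f: "integrable circle_measure f" "\<And>n. fourier_coeff f n = 0"
    and "closed B"
  shows "(LINT t:cis -` B|circle_measure. f t) = 0"
proof (cases "B = {}")
  case False
  define h where "h k z = max 0 (1 - real k * infdist z B)" for k z
  have "(\<lambda>k. LINT t|circle_measure. f t * of_real (h k (cis t)))
      \<longlonglongrightarrow> (LINT t|circle_measure. f t * indicator B (cis t))"
  proof (rule integral_dominated_convergence[where w = "\<lambda>t. norm (f t)"])
    have "(\<lambda>k. h k z) \<longlonglongrightarrow> indicator B z" for z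
    proof (cases "z \<in> B")
      case False
      then have "infdist z B > 0"
        using \<open>closed B\<close> \<open>B \<noteq> {}\<close> by (metis in_closed_iff_infdist_zero infdist_nonneg less_eq_real_def)
      then obtain K where K: "1 < real K * infdist z B"
        by (metis reals_Archimedean3)
      have "h k z = 0" if "k \<ge> K" for k
        using K mult_right_mono[of "real K" "real k" "infdist z B"] that \<open>infdist z B > 0\<close>
        by (simp only: h_def) linarith
      then show ?thesis
        using False by (intro tendsto_eventually) (auto simp: eventually_sequentially)
    qed (simp add: h_def)
    then show "AE t in circle_measure. (\<lambda>k. f t * of_real (h k (cis t))) \<longlonglongrightarrow> f t * indicator B (cis t)"
      by (intro AE_I2 tendsto_mult tendsto_const)
         (metis of_real_indicator tendsto_of_real)
    show "AE t in circle_measure. norm (f t * of_real (h k (cis t))) \<le> norm (f t)" for k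
      by (simp add: h_def norm_mult infdist_nonneg mult_left_le)
    show "(\<lambda>t. f t * of_real (h k (cis t))) \<in> borel_measurable circle_measure" for k
      unfolding h_def using borel_measurable_integrable[OF f(1)]
      by (intro borel_measurable_times borel_measurable_of_real borel_measurable_max
            borel_measurable_diff borel_measurable_times)
         (auto intro!: borel_measurable_continuous_onI continuous_intros)
    have "(indicator B :: complex \<Rightarrow> complex) \<in> borel_measurable borel"
      using \<open>closed B\<close> by simp
    then show "(\<lambda>t. f t * indicator B (cis t)) \<in> borel_measurable circle_measure"
      using borel_measurable_integrable[OF f(1)]
      by (intro borel_measurable_times measurable_compose[of cis _ borel "indicator B"])
         (auto intro!: borel_measurable_continuous_onI continuous_intros)
  qed (use f in auto)
  moreover have "(LINT t|circle_measure. f t * of_real (h k (cis t))) = 0" for k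
    unfolding h_def by (intro integral_vanish_mult_continuous f continuous_intros)
  ultimately have "(LINT t|circle_measure. f t * indicator B (cis t)) = 0"
    by (simp add: LIMSEQ_const_iff)
  moreover have "f t * indicator B (cis t) = indicator (cis -` B) t *\<^sub>R f t" for t
    by (simp add: indicator_def)
  ultimately show ?thesis
    by (simp only: set_lebesgue_integral_def)
qed (simp add: set_lebesgue_integral_def)

lemma cis_vimage_borel:
  assumes "B \<in> sets borel"
  shows "cis -` B \<in> sets borel"
  using measurable_sets_borel[OF borel_measurable_continuous_onI assms, of cis]
  by (simp add: continuous_on_cis continuous_on_id)

lemma set_integral_cis_vimage:
  assumes f: "integrable circle_measure f" "\<And>n. fourier_coeff f n = 0"
    and "B \<in> sets borel"
  shows "(LINT t:cis -` B|circle_measure. f t) = 0"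
proof -
  have si: "set_integrable circle_measure (cis -` B) f" if "B \<in> sets borel" for B
    using integrable_mult_indicator[OF _ f(1), of "cis -` B"] cis_vimage_borel[OF that]
    by (simp add: set_integrable_def)
  have B: "B \<in> sigma_sets UNIV (Collect closed)"
    using assms(3) by (simp add: borel_eq_closed)
  show ?thesis
  proof (induction rule: sigma_sets_induct_disjoint[OF _ _ B, case_names stable pow closed empty compl union])
    case (compl B)
    then have B: "B \<in> sets borel" by (simp add: borel_eq_closed)
    have "(LINT t:cis -` B \<union> cis -` (-B)|circle_measure. f t)
        = (LINT t:cis -` B|circle_measure. f t) + (LINT t:cis -` (-B)|circle_measure. f t)"
      using B by (intro set_integral_Un si) auto
    moreover have "cis -` B \<union> cis -` (-B) = cis -` UNIV" by auto
    moreover have "(LINT t:cis -` UNIV|circle_measure. f t) = 0"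
      by (rule set_integral_cis_vimage_closed[OF f closed_UNIV])
    moreover have "(LINT t:cis -` B|circle_measure. f t) = 0"
      by (rule compl)
    ultimately show ?case
      unfolding Compl_eq_Diff_UNIV by (simp only: add_0)
  next
    case (union A)
    then have A: "A i \<in> sets borel" for i
      by (auto simp: borel_eq_closed)
    have "(LINT t:(\<Union>i. cis -` A i)|circle_measure. f t) = (\<Sum>i. LINT t:cis -` A i|circle_measure. f t)"
    proof (rule lebesgue_integral_countable_add)
      show "set_integrable circle_measure (\<Union>i. cis -` A i) f"
        using si[of "\<Union>i. A i"] A by (simp add: vimage_UN)
    qed (use A cis_vimage_borel union(1) in \<open>simp_all add: disjoint_family_on_def, blast\<close>)
    moreover have "(LINT t:cis -` A i|circle_measure. f t) = 0" for i
      by (rule union(3))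
    ultimately show ?case
      by (simp only: vimage_UN suminf_zero)
  next
    case (closed A)
    then show ?case by (intro set_integral_cis_vimage_closed f) simp
  next
    case empty
    show ?case by (simp add: set_lebesgue_integral_def)
  next
    case stable
    show ?case by (simp add: Int_stable_def closed_Int)
  next
    case pow
    show ?case by simp
  qed
qed

text \<open>
  Integrals over preimages under \<open>cis\<close> determine \<open>f\<close>, since up to a null set every Borel subset of
  the interval is such a preimage: \<open>Arg2pi\<close> inverts \<open>cis\<close> on the open interval and is continuous off
  the positive half-axis.
\<close>

theorem fourier_coeff_unique:
  assumes f: "integrable circle_measure f" "\<And>n. fourier_coeff f n = 0"
  shows "AE t in circle_measure. f t = 0"
proof (rule circle.density_zero[OF f(1)])
  fix A :: "real set"
  assume "A \<in> sets circle_measure"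
  then have A: "A \<in> sets borel" by simp
  let ?U = "- \<real>\<^sub>\<ge>\<^sub>0 :: complex set"
  let ?B = "Arg2pi -` A \<inter> ?U"
  have "continuous_on ?U Arg2pi"
    by (intro continuous_at_imp_continuous_on ballI continuous_at_Arg2pi) simp
  then have "Arg2pi \<in> borel_measurable (restrict_space borel ?U)"
    by (rule borel_measurable_continuous_on_restrict)
  from measurable_sets[OF this A] have "?B \<in> sets (restrict_space borel ?U)"
    by (simp add: space_restrict_space)
  moreover have "?U \<in> sets borel"
    by (intro borel_open open_Compl closed_nonneg_Reals_complex)
  ultimately have "?B \<in> sets borel"
    by (simp add: sets_restrict_space_iff)
  have cis: "cis t \<in> ?B \<longleftrightarrow> t \<in> A" if "0 < t" "t < 2 * pi" for t
  proof -
    have "Arg2pi (cis t) = t"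
      using that by (intro Arg2pi_unique[of 1]) (auto simp: cis_conv_exp)
    moreover have "cis t \<notin> \<real>\<^sub>\<ge>\<^sub>0"
      using calculation that by (metis Arg2pi_eq_0 complex_nonneg_Reals_iff complex_is_Real_iff less_irrefl)
    ultimately show ?thesis by simp
  qed
  have "AE t in circle_measure. t \<noteq> 0 \<and> t \<noteq> 2 * pi"
    unfolding AE_circle_measure
    using AE_lborel_singleton[of 0] AE_lborel_singleton[of "2 * pi"] by eventually_elim simp
  moreover have "AE t in circle_measure. t \<in> {0..2*pi}"
    unfolding AE_circle_measure by simp
  ultimately have "AE t in circle_measure. t \<in> A \<longleftrightarrow> t \<in> cis -` ?B"
    by eventually_elim (use cis in auto)
  then have "(LINT t:A|circle_measure. f t) = (LINT t:cis -` ?B|circle_measure. f t)"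
    using A cis_vimage_borel[OF \<open>?B \<in> sets borel\<close>] borel_measurable_integrable[OF f(1)]
    unfolding set_lebesgue_integral_def
    by (intro integral_cong_AE borel_measurable_scaleR borel_measurable_indicator)
       (simp_all, auto elim!: eventually_mono simp: indicator_def)
  then show "(LINT t:A|circle_measure. f t) = 0"
    using set_integral_cis_vimage[OF f \<open>?B \<in> sets borel\<close>] by simp
qed

section \<open>Lebesgue spaces and Fourier coefficients\<close>

lemma circle_eq_rep: "circle_eq (rep_circle_fun F) (rep_circle_fun F)"
  using Quotient3_rel_rep[OF Quotient3_circle_fun, of F F] by simp

lemma abs_rep_circle_fun: "abs_circle_fun (rep_circle_fun F) = F"
  by (rule Quotient3_abs_rep[OF Quotient3_circle_fun])

lemma rep_circle_fun_measurable [measurable]: "rep_circle_fun F \<in> borel_measurable borel"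
  using circle_eq_rep[of F] by (simp add: circle_eq_def)

lemma AE_rep_abs_circle_fun:
  "circle_eq f f \<Longrightarrow> AE t in circle_measure. rep_circle_fun (abs_circle_fun f) t = f t"
  using Quotient3_rep_abs[OF Quotient3_circle_fun, of f] by (simp add: circle_eq_def)

lemma abs_circle_fun_eq_iff:
  "circle_eq f f \<Longrightarrow> circle_eq g g \<Longrightarrow>
    abs_circle_fun f = abs_circle_fun g \<longleftrightarrow> (AE t in circle_measure. f t = g t)"
  using Quotient3_rel[OF Quotient3_circle_fun, of f g] by (auto simp: circle_eq_def)

lemma AE_rep_minus:
  "AE t in circle_measure. rep_circle_fun (F - G) t = rep_circle_fun F t - rep_circle_fun G t"
proof -
  have *: "F - G = abs_circle_fun (\<lambda>t. rep_circle_fun F t - rep_circle_fun G t)"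
    by (simp add: minus_circle_fun_def)
  show ?thesis
    unfolding * by (rule AE_rep_abs_circle_fun)
      (use circle_eq_rep[of F] circle_eq_rep[of G] in \<open>auto simp: circle_eq_def periodic_def\<close>)
qed

lemma AE_rep_scaleC:
  "AE t in circle_measure. rep_circle_fun (c *\<^sub>C F) t = c * rep_circle_fun F t"
proof -
  have *: "c *\<^sub>C F = abs_circle_fun (\<lambda>t. c * rep_circle_fun F t)"
    by (simp add: scaleC_circle_fun_def)
  show ?thesis
    unfolding * by (rule AE_rep_abs_circle_fun)
      (use circle_eq_rep[of F] in \<open>auto simp: circle_eq_def periodic_def\<close>)
qed

lemma exponent_cases:
  assumes "1 \<le> p"
  obtains "p = \<infinity>" | r where "p = ereal r" "1 \<le> r"
  using assms by (cases p) auto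

lemma Lp_infinity_iff:
  "F \<in> Lp \<infinity> \<longleftrightarrow> (\<exists>M. AE t in circle_measure. norm (rep_circle_fun F t) \<le> M)"
proof
  let ?S = "esssup circle_measure (\<lambda>t. ereal (norm (rep_circle_fun F t)))"
  assume "F \<in> Lp \<infinity>"
  then have "?S < \<infinity>" by (simp add: Lp_def)
  then obtain M where "?S \<le> ereal M"
    by (cases ?S) auto
  then have "AE t in circle_measure. norm (rep_circle_fun F t) \<le> M"
    by (intro eventually_mono[OF esssup_AE[of "\<lambda>t. ereal (norm (rep_circle_fun F t))" circle_measure]])
      (meson ereal_less_eq(3) order.trans)
  then show "\<exists>M. AE t in circle_measure. norm (rep_circle_fun F t) \<le> M" ..
next
  assume "\<exists>M. AE t in circle_measure. norm (rep_circle_fun F t) \<le> M"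
  then obtain M where "AE t in circle_measure. norm (rep_circle_fun F t) \<le> M" ..
  then have "esssup circle_measure (\<lambda>t. ereal (norm (rep_circle_fun F t))) \<le> ereal M"
    by (intro esssup_I) auto
  then show "F \<in> Lp \<infinity>"
    by (auto simp: Lp_def)
qed

lemma AE_norm_le_Lp_norm_infinity:
  assumes "F \<in> Lp \<infinity>"
  shows "AE t in circle_measure. norm (rep_circle_fun F t) \<le> Lp_norm \<infinity> F"
proof -
  let ?S = "esssup circle_measure (\<lambda>t. ereal (norm (rep_circle_fun F t)))"
  have "0 = esssup circle_measure (\<lambda>t. 0 :: ereal)"
    by (rule esssup_const[symmetric]) (simp add: circle.emeasure_space_1 flip: space_circle_measure)
  also have "\<dots> \<le> ?S"
    by (rule esssup_mono) auto
  finally have "0 \<le> ?S" .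
  moreover have "?S < \<infinity>" using assms by (simp add: Lp_def)
  ultimately have "?S = ereal (Lp_norm \<infinity> F)"
    by (cases ?S) (auto simp: Lp_norm_def)
  then show ?thesis
    using esssup_AE[of "\<lambda>t. ereal (norm (rep_circle_fun F t))" circle_measure] by simp
qed

lemma Lp_minus:
  assumes "1 \<le> p" "F \<in> Lp p" "G \<in> Lp p"
  shows "F - G \<in> Lp p"
  using assms(1)
proof (cases rule: exponent_cases)
  case 1
  then obtain M N where "AE t in circle_measure. norm (rep_circle_fun F t) \<le> M"
    "AE t in circle_measure. norm (rep_circle_fun G t) \<le> N"
    using assms by (auto simp: Lp_infinity_iff)
  with AE_rep_minus[of F G]
  have "AE t in circle_measure. norm (rep_circle_fun (F - G) t) \<le> M + N"
    by eventually_elim (auto intro: order.trans[OF norm_triangle_ineq4] add_mono)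
  then show ?thesis using 1 by (auto simp: Lp_infinity_iff)
next
  case (2 r)
  let ?w = "\<lambda>t. 2 powr r * (norm (rep_circle_fun F t) powr r + norm (rep_circle_fun G t) powr r)"
  have bound: "norm (x - y) powr r \<le> 2 powr r * (norm x powr r + norm y powr r)" for x y :: complex
  proof -
    have "norm (x - y) powr r \<le> (2 * max (norm x) (norm y)) powr r"
      using norm_triangle_ineq4[of x y] \<open>1 \<le> r\<close> by (intro powr_mono2) auto
    also have "\<dots> = 2 powr r * max (norm x) (norm y) powr r"
      by (simp add: powr_mult)
    also have "\<dots> \<le> 2 powr r * (norm x powr r + norm y powr r)"
      by (intro mult_left_mono) (auto simp: max_def)
    finally show ?thesis .
  qed
  have "integrable circle_measure (\<lambda>t. norm (rep_circle_fun (F - G) t) powr r)"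
  proof (rule Bochner_Integration.integrable_bound)
    show "integrable circle_measure ?w"
      using assms 2 by (simp add: Lp_def)
    show "AE t in circle_measure. norm (norm (rep_circle_fun (F - G) t) powr r) \<le> norm (?w t)"
      using AE_rep_minus[of F G] by eventually_elim (use bound in auto)
  qed simp
  then show ?thesis using 2 by (simp add: Lp_def)
qed

lemma Lp_scaleC:
  assumes "1 \<le> p" "F \<in> Lp p"
  shows "c *\<^sub>C F \<in> Lp p"
  using assms(1)
proof (cases rule: exponent_cases)
  case 1
  then obtain M where "AE t in circle_measure. norm (rep_circle_fun F t) \<le> M"
    using assms by (auto simp: Lp_infinity_iff)
  with AE_rep_scaleC[of c F]
  have "AE t in circle_measure. norm (rep_circle_fun (c *\<^sub>C F) t) \<le> norm c * M"
    by eventually_elim (auto simp: norm_mult mult_left_mono)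
  then show ?thesis using 1 by (auto simp: Lp_infinity_iff)
next
  case (2 r)
  have "integrable circle_measure (\<lambda>t. norm c powr r * norm (rep_circle_fun F t) powr r)"
    using assms 2 by (simp add: Lp_def)
  also have "?this \<longleftrightarrow> integrable circle_measure (\<lambda>t. norm (rep_circle_fun (c *\<^sub>C F) t) powr r)"
    using AE_rep_scaleC[of c F]
    by (intro integrable_cong_AE) (auto elim!: eventually_mono simp: norm_mult powr_mult)
  finally show ?thesis using 2 by (simp add: Lp_def)
qed

text \<open>
  Monotonicity of the \<open>L\<^sup>r\<close> norms on a probability space. With \<open>l\<close> the \<open>L\<^sup>r\<close> norm of \<open>g\<close>, Young's
  inequality bounds \<open>g / l\<close> by \<open>(g / l)\<^sup>r / r + (1 - 1 / r)\<close>, whose integral is \<open>1\<close>.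
\<close>

lemma (in prob_space) integral_le_powr_integral_powr:
  fixes g :: "'a \<Rightarrow> real"
  assumes [measurable]: "g \<in> borel_measurable M" and "\<And>x. 0 \<le> g x" and "1 \<le> r"
    and int: "integrable M (\<lambda>x. g x powr r)"
  shows "integrable M g" "(LINT x|M. g x) \<le> (LINT x|M. g x powr r) powr (1 / r)"
proof -
  show g: "integrable M g"
  proof (rule Bochner_Integration.integrable_bound)
    show "integrable M (\<lambda>x. 1 + g x powr r)"
      using int by simp
    have "g x \<le> 1 + g x powr r" for x
      using powr_mono[of 1 r "g x"] assms(2)[of x] \<open>1 \<le> r\<close>
      by (cases "g x \<le> 1") (auto intro: add_increasing2 add_increasing)
    then show "AE x in M. norm (g x) \<le> norm (1 + g x powr r)"
      using assms(2) by (auto simp: abs_of_nonneg add_nonneg_nonneg)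
  qed simp
  define I where "I = (LINT x|M. g x powr r)"
  show "(LINT x|M. g x) \<le> (LINT x|M. g x powr r) powr (1 / r)"
  proof (cases "I = 0")
    case True
    then have "AE x in M. g x powr r = 0"
      using integral_nonneg_eq_0_iff_AE[OF int] by (simp add: I_def)
    then have "(LINT x|M. g x) = (LINT x|M. 0)"
      by (intro integral_cong_AE) auto
    then show ?thesis by simp
  next
    case False
    then have "I > 0"
      by (simp add: I_def less_le integral_nonneg_AE)
    define l where "l = I powr (1 / r)"
    have "l > 0" "l powr r = I"
      using \<open>I > 0\<close> \<open>1 \<le> r\<close> by (auto simp: l_def powr_powr)
    have "g x \<le> l / r / I * g x powr r + l * (1 - 1 / r)" for x
    proof (cases "g x = 0")
      case False
      then have "g x > 0" using assms(2)[of x] by simp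
      then have "(g x powr r / I) powr (1 / r) * 1 powr (1 - 1 / r)
          \<le> (1 / r) * (g x powr r / I) + (1 - 1 / r) * 1"
        using \<open>I > 0\<close> \<open>1 \<le> r\<close> by (intro Youngs_inequality_0) auto
      moreover have "(g x powr r / I) powr (1 / r) = g x / l"
        using \<open>I > 0\<close> \<open>1 \<le> r\<close> \<open>g x > 0\<close> by (simp add: powr_divide powr_powr l_def)
      ultimately have "l * (g x / l) \<le> l * ((1 / r) * (g x powr r / I) + (1 - 1 / r))"
        using \<open>l > 0\<close> by (intro mult_left_mono) auto
      then show ?thesis
        using \<open>l > 0\<close> by (simp add: algebra_simps)
    qed (use \<open>1 \<le> r\<close> \<open>l > 0\<close> in auto)
    then have "(LINT x|M. g x) \<le> (LINT x|M. l / r / I * g x powr r + l * (1 - 1 / r))"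
      using g int by (intro integral_mono) auto
    also have "\<dots> = l / r / I * I + l * (1 - 1 / r)"
      using int by (simp add: prob_space I_def)
    also have "\<dots> = l"
      using \<open>I > 0\<close> \<open>1 \<le> r\<close> by (simp add: field_simps)
    finally show ?thesis by (simp add: l_def I_def)
  qed
qed

lemma Lp_integrable:
  assumes "1 \<le> p" "F \<in> Lp p"
  shows "integrable circle_measure (rep_circle_fun F)"
    "(LINT t|circle_measure. norm (rep_circle_fun F t)) \<le> Lp_norm p F"
proof -
  have "integrable circle_measure (\<lambda>t. norm (rep_circle_fun F t)) \<and>
    (LINT t|circle_measure. norm (rep_circle_fun F t)) \<le> Lp_norm p F"
    using assms(1)
  proof (cases rule: exponent_cases)
    case 1
    then have AE: "AE t in circle_measure. norm (rep_circle_fun F t) \<le> Lp_norm p F"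
      using AE_norm_le_Lp_norm_infinity assms by blast
    then have i: "integrable circle_measure (\<lambda>t. norm (rep_circle_fun F t))"
      by (intro circle.integrable_const_bound[of _ "Lp_norm p F"]) auto
    have "(LINT t|circle_measure. norm (rep_circle_fun F t)) \<le> (LINT t|circle_measure. Lp_norm p F)"
      using AE i by (intro integral_mono_AE) auto
    then show ?thesis using i circle.prob_space by simp
  next
    case (2 r)
    then show ?thesis
      using circle.integral_le_powr_integral_powr[of "\<lambda>t. norm (rep_circle_fun F t)" r] assms
      by (auto simp: Lp_def Lp_norm_def)
  qed
  then show "integrable circle_measure (rep_circle_fun F)"
    "(LINT t|circle_measure. norm (rep_circle_fun F t)) \<le> Lp_norm p F"
    by (auto simp: integrable_norm_iff)
qed

lemma norm_fourier_coeff_le: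
  "norm (fourier_coeff f n) \<le> (LINT t|circle_measure. norm (f t))"
  unfolding fourier_coeff_eq
  by (rule order.trans[OF integral_norm_bound]) (simp add: norm_mult)

lemma norm_fourier_coeff_le_Lp_norm:
  "1 \<le> p \<Longrightarrow> F \<in> Lp p \<Longrightarrow> norm (fourier_coeff (rep_circle_fun F) n) \<le> Lp_norm p F"
  using norm_fourier_coeff_le Lp_integrable(2) by (rule order.trans)

lemma fourier_coeff_cong_AE:
  assumes "AE t in circle_measure. f t = g t" "f \<in> borel_measurable borel" "g \<in> borel_measurable borel"
  shows "fourier_coeff f n = fourier_coeff g n"
  unfolding fourier_coeff_eq using assms(1)
  by (intro integral_cong_AE) (use assms(2,3) in \<open>auto elim!: eventually_mono\<close>)

lemma fourier_coeff_rep_abs: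
  "circle_eq f f \<Longrightarrow> fourier_coeff (rep_circle_fun (abs_circle_fun f)) n = fourier_coeff f n"
  by (rule fourier_coeff_cong_AE[OF AE_rep_abs_circle_fun]) (auto simp: circle_eq_def)

lemma fourier_coeff_diff:
  "integrable circle_measure f \<Longrightarrow> integrable circle_measure g \<Longrightarrow>
    fourier_coeff (\<lambda>t. f t - g t) n = fourier_coeff f n - fourier_coeff g n"
  unfolding fourier_coeff_eq left_diff_distrib
  by (intro Bochner_Integration.integral_diff integrable_mult_character)

lemma fourier_coeff_rep_minus:
  assumes "1 \<le> p" "F \<in> Lp p" "G \<in> Lp p"
  shows "fourier_coeff (rep_circle_fun (F - G)) n
    = fourier_coeff (rep_circle_fun F) n - fourier_coeff (rep_circle_fun G) n"
proof -
  have "fourier_coeff (rep_circle_fun (F - G)) n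
      = fourier_coeff (\<lambda>t. rep_circle_fun F t - rep_circle_fun G t) n"
    by (rule fourier_coeff_cong_AE[OF AE_rep_minus]) auto
  then show ?thesis
    using Lp_integrable(1)[OF assms(1)] assms(2,3) by (simp add: fourier_coeff_diff)
qed

lemma fourier_coeff_rep_scaleC:
  "fourier_coeff (rep_circle_fun (c *\<^sub>C F)) n = c * fourier_coeff (rep_circle_fun F) n"
proof -
  have "fourier_coeff (rep_circle_fun (c *\<^sub>C F)) n = fourier_coeff (\<lambda>t. c * rep_circle_fun F t) n"
    by (rule fourier_coeff_cong_AE[OF AE_rep_scaleC]) auto
  then show ?thesis
    by (simp add: fourier_coeff_eq mult.assoc)
qed

lemma Lp_eqI:
  assumes "1 \<le> p" "F \<in> Lp p" "G \<in> Lp p"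
    and "\<And>n. fourier_coeff (rep_circle_fun F) n = fourier_coeff (rep_circle_fun G) n"
  shows "F = G"
proof -
  have "AE t in circle_measure. rep_circle_fun F t - rep_circle_fun G t = 0"
    using Lp_integrable(1)[OF assms(1)] assms
    by (intro fourier_coeff_unique) (simp_all add: fourier_coeff_diff)
  then have "abs_circle_fun (rep_circle_fun F) = abs_circle_fun (rep_circle_fun G)"
    by (simp add: abs_circle_fun_eq_iff circle_eq_rep)
  then show ?thesis by (simp add: abs_rep_circle_fun)
qed

lemma Lp_bounded:
  assumes "1 \<le> p" "circle_eq f f" and bound: "\<And>t. norm (f t) \<le> M"
  shows "abs_circle_fun f \<in> Lp p" "Lp_norm p (abs_circle_fun f) \<le> M"
proof -
  let ?F = "abs_circle_fun f"
  have AE: "AE t in circle_measure. norm (rep_circle_fun ?F t) \<le> M"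
    using AE_rep_abs_circle_fun[OF assms(2)] by eventually_elim (use bound in simp)
  have "M \<ge> 0" using bound[of 0] norm_ge_zero order.trans by blast
  have "?F \<in> Lp p \<and> Lp_norm p ?F \<le> M"
    using assms(1)
  proof (cases rule: exponent_cases)
    case 1
    have F: "?F \<in> Lp \<infinity>" using AE by (auto simp: Lp_infinity_iff)
    moreover have "esssup circle_measure (\<lambda>t. ereal (norm (rep_circle_fun ?F t))) \<le> ereal M"
      using AE by (intro esssup_I) auto
    then have "Lp_norm \<infinity> ?F \<le> M"
      using \<open>M \<ge> 0\<close> by (cases "esssup circle_measure (\<lambda>t. ereal (norm (rep_circle_fun ?F t)))")
        (auto simp: Lp_norm_def)
    ultimately show ?thesis using 1 by simp
  next
    case (2 r)
    have AE': "AE t in circle_measure. norm (rep_circle_fun ?F t) powr r \<le> M powr r"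
      using AE by eventually_elim (use 2 in \<open>auto intro: powr_mono2\<close>)
    then have i: "integrable circle_measure (\<lambda>t. norm (rep_circle_fun ?F t) powr r)"
      by (intro circle.integrable_const_bound[of _ "M powr r"]) auto
    have "(LINT t|circle_measure. norm (rep_circle_fun ?F t) powr r) \<le> (LINT t|circle_measure. M powr r)"
      using AE' i by (intro integral_mono_AE) auto
    then have "(LINT t|circle_measure. norm (rep_circle_fun ?F t) powr r) \<le> M powr r"
      using circle.prob_space by simp
    then have "(LINT t|circle_measure. norm (rep_circle_fun ?F t) powr r) powr (1 / r) \<le> (M powr r) powr (1 / r)"
      using 2 by (intro powr_mono2) (auto intro: integral_nonneg_AE)
    also have "\<dots> = M"
      using 2 \<open>M \<ge> 0\<close> by (simp add: powr_powr)
    finally show ?thesis using 2 i by (simp add: Lp_def Lp_norm_def)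
  qed
  then show "?F \<in> Lp p" "Lp_norm p ?F \<le> M" by auto
qed

lemma Lp_norm_nonneg:
  assumes "1 \<le> p" "F \<in> Lp p"
  shows "0 \<le> Lp_norm p F"
  by (rule order.trans[OF _ Lp_integrable(2)[OF assms]]) simp

lemma Lp_zero: "1 \<le> p \<Longrightarrow> 0 \<in> Lp p"
  unfolding zero_circle_fun_def by (rule Lp_bounded[where M = 0]) (auto simp: circle_eq_def periodic_def)

lemma fourier_coeff_rep_zero: "fourier_coeff (rep_circle_fun 0) n = 0"
  using fourier_coeff_rep_scaleC[of 0 0 n] by simp

section \<open>Smooth functions and rapidly decreasing sequences\<close>

lemma integrable_circle_continuous:
  fixes f :: "real \<Rightarrow> complex"
  assumes "continuous_on UNIV f"
  shows "integrable circle_measure f"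
proof -
  have "bounded (f ` {0..2*pi})"
    by (intro compact_imp_bounded compact_continuous_image continuous_on_subset[OF assms]) auto
  then obtain M where M: "\<And>t. t \<in> {0..2*pi} \<Longrightarrow> norm (f t) \<le> M"
    unfolding bounded_iff by blast
  then have "AE t in circle_measure. norm (f t) \<le> M"
    unfolding AE_circle_measure by simp
  then show ?thesis
    by (rule circle.integrable_const_bound) (use assms in \<open>simp add: borel_measurable_continuous_onI\<close>)
qed

lemma integral_circle_vector_derivative:
  fixes F :: "real \<Rightarrow> complex"
  assumes F: "\<And>t. (F has_vector_derivative f t) (at t)"
    and f: "continuous_on UNIV f" and per: "F (2 * pi) = F 0"
  shows "(LINT t|circle_measure. f t) = 0"
proof -
  have "(LINT t:{0..2*pi}|lborel. f t) = F (2 * pi) - F 0"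
    unfolding set_lebesgue_integral_def
    by (rule integral_FTC_atLeastAtMost)
       (use F f in \<open>auto intro: has_vector_derivative_at_within continuous_on_subset\<close>)
  then show ?thesis
    using per f by (simp add: integral_circle_measure borel_measurable_continuous_onI)
qed

lemma character_has_vector_derivative:
  "(character n has_vector_derivative \<i> * of_int n * character n t) (at t)"
proof -
  have "character n = (\<lambda>t. exp (t *\<^sub>R (\<i> * of_int n)))"
    by (simp add: fun_eq_iff character_def cis_conv_exp scaleR_conv_of_real mult_ac)
  then show ?thesis
    using exp_scaleR_has_vector_derivative_right[of "\<i> * of_int n" t] by (simp add: mult.commute)
qed

lemma character_periodic: "character n (t + 2 * pi) = character n t"
proof -
  have "character n (t + 2 * pi) = character n t * cis (2 * pi * of_int n)"
    by (simp add: character_def cis_mult algebra_simps)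
  then show ?thesis by (simp add: cis_multiple_2pi)
qed

lemma continuous_on_character: "continuous_on A (character n)"
  unfolding character_def by (intro continuous_intros)

lemma integral_character: "(LINT t|circle_measure. character n t) = of_bool (n = 0)"
proof (cases "n = 0")
  case False
  have "(LINT t|circle_measure. \<i> * of_int n * character n t) = 0"
  proof (rule integral_circle_vector_derivative[OF character_has_vector_derivative])
    show "character n (2 * pi) = character n 0"
      using character_periodic[of n 0] by simp
  qed (intro continuous_intros continuous_on_character)
  then show ?thesis using False by simp
qed (use circle.prob_space in simp)

definition rapidly_decreasing :: "(int \<Rightarrow> complex) \<Rightarrow> bool" where
  "rapidly_decreasing a \<longleftrightarrow> (\<forall>m. \<exists>C. \<forall>n. real_of_int \<bar>n\<bar> ^ m * norm (a n) \<le> C)"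

text \<open>
  The series \<open>\<Sum> a\<^sub>n e\<^sup>i\<^sup>n\<^sup>t\<close> over all integers \<open>n\<close>, enumerated along \<open>int_decode\<close> so that the results on
  sequences of functions apply; it is used for absolutely summable \<open>a\<close> only.
\<close>

definition trig_series :: "(int \<Rightarrow> complex) \<Rightarrow> real \<Rightarrow> complex" where
  "trig_series a t = (\<Sum>k. a (int_decode k) * character (int_decode k) t)"

lemma rapidly_decreasing_le:
  assumes "rapidly_decreasing a" and le: "\<And>n. norm (b n) \<le> K * norm (a n)"
  shows "rapidly_decreasing b"
  unfolding rapidly_decreasing_def
proof
  fix m
  obtain C where C: "\<And>n. real_of_int \<bar>n\<bar> ^ m * norm (a n) \<le> C"
    using assms(1) unfolding rapidly_decreasing_def by blast
  have "real_of_int \<bar>n\<bar> ^ m * norm (b n) \<le> \<bar>K\<bar> * C" for n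
  proof -
    have "norm (b n) \<le> \<bar>K\<bar> * norm (a n)"
      using le[of n] by (smt (verit) mult_right_mono norm_ge_zero)
    then have "real_of_int \<bar>n\<bar> ^ m * norm (b n) \<le> real_of_int \<bar>n\<bar> ^ m * (\<bar>K\<bar> * norm (a n))"
      by (intro mult_left_mono) auto
    also have "\<dots> = \<bar>K\<bar> * (real_of_int \<bar>n\<bar> ^ m * norm (a n))" by simp
    also have "\<dots> \<le> \<bar>K\<bar> * C"
      using C by (intro mult_left_mono) auto
    finally show ?thesis .
  qed
  then show "\<exists>C. \<forall>n. real_of_int \<bar>n\<bar> ^ m * norm (b n) \<le> C" by blast
qed

lemma rapidly_decreasing_cmult: "rapidly_decreasing a \<Longrightarrow> rapidly_decreasing (\<lambda>n. c * a n)"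
  by (rule rapidly_decreasing_le[where K = "norm c"]) (auto simp: norm_mult)

lemma rapidly_decreasing_0: "rapidly_decreasing (\<lambda>n. 0)"
  by (auto simp: rapidly_decreasing_def)

lemma rapidly_decreasing_add:
  assumes "rapidly_decreasing a" "rapidly_decreasing b"
  shows "rapidly_decreasing (\<lambda>n. a n + b n)"
  unfolding rapidly_decreasing_def
proof
  fix m
  obtain C D where "\<And>n. real_of_int \<bar>n\<bar> ^ m * norm (a n) \<le> C" "\<And>n. real_of_int \<bar>n\<bar> ^ m * norm (b n) \<le> D"
    using assms unfolding rapidly_decreasing_def by metis
  then have "real_of_int \<bar>n\<bar> ^ m * norm (a n) + real_of_int \<bar>n\<bar> ^ m * norm (b n) \<le> C + D" for n
    by (rule add_mono)
  moreover have "real_of_int \<bar>n\<bar> ^ m * norm (a n + b n)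
      \<le> real_of_int \<bar>n\<bar> ^ m * norm (a n) + real_of_int \<bar>n\<bar> ^ m * norm (b n)" for n
    using mult_left_mono[OF norm_triangle_ineq[of "a n" "b n"], of "real_of_int \<bar>n\<bar> ^ m"]
    by (simp add: distrib_left)
  ultimately show "\<exists>C. \<forall>n. real_of_int \<bar>n\<bar> ^ m * norm (a n + b n) \<le> C"
    using order.trans by blast
qed

lemma rapidly_decreasing_mult_freq:
  assumes "rapidly_decreasing a"
  shows "rapidly_decreasing (\<lambda>n. \<i> * of_int n * a n)"
  unfolding rapidly_decreasing_def
proof
  fix m
  obtain C where C: "\<And>n. real_of_int \<bar>n\<bar> ^ Suc m * norm (a n) \<le> C"
    using assms unfolding rapidly_decreasing_def by metis
  have "real_of_int \<bar>n\<bar> ^ m * norm (\<i> * of_int n * a n) = real_of_int \<bar>n\<bar> ^ Suc m * norm (a n)" for n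
    by (simp add: norm_mult)
  then show "\<exists>C. \<forall>n. real_of_int \<bar>n\<bar> ^ m * norm (\<i> * of_int n * a n) \<le> C"
    using C by metis
qed

lemma rapidly_decreasing_mult_freq_power:
  "rapidly_decreasing a \<Longrightarrow> rapidly_decreasing (\<lambda>n. (\<i> * of_int n) ^ k * a n)"
proof (induction k)
  case (Suc k)
  from rapidly_decreasing_mult_freq[OF Suc.IH[OF Suc.prems]] show ?case by (simp add: mult.assoc)
qed simp

lemma rapidly_decreasing_mult_poly:
  assumes "rapidly_decreasing a"
  shows "rapidly_decreasing (\<lambda>n. poly P (\<i> * of_int n) * a n)"
proof -
  have "rapidly_decreasing (\<lambda>n. \<Sum>k\<in>A. coeff P k * ((\<i> * of_int n) ^ k * a n))" if "finite A" for A
    using that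
  proof (induction A)
    case (insert k A)
    then show ?case
      by (simp del: mult.assoc)
         (intro rapidly_decreasing_add rapidly_decreasing_cmult rapidly_decreasing_mult_freq_power assms)
  qed (simp add: rapidly_decreasing_0)
  from this[of "{..degree P}"] show ?thesis
    by (simp add: poly_altdef sum_distrib_right mult.assoc)
qed

lemma rapidly_decreasing_summable:
  assumes "rapidly_decreasing a"
  shows "summable (\<lambda>k. norm (a (int_decode k)))"
proof -
  \<comment> \<open>decay of order \<open>2\<close> suffices, with the moments of order \<open>0\<close> and \<open>2\<close> for small and large \<open>|n|\<close>\<close>
  obtain C where "\<And>n. real_of_int \<bar>n\<bar> ^ 0 * norm (a n) \<le> C"
    using assms unfolding rapidly_decreasing_def by blast
  then have C: "norm (a n) \<le> C" for n by simp
  obtain D where D: "\<And>n. real_of_int \<bar>n\<bar> ^ 2 * norm (a n) \<le> D"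
    using assms unfolding rapidly_decreasing_def by blast
  show ?thesis
  proof (rule summable_comparison_test')
    show "summable (\<lambda>k. (2 * C + 8 * D) * inverse (real (Suc k) ^ 2))"
      using inverse_power_summable[of 2, where 'a = real]
      by (intro summable_mult) (subst summable_Suc_iff, simp)
    fix k :: nat
    let ?n = "int_decode k"
    \<comment> \<open>the enumeration runs through \<open>0, -1, 1, -2, 2, \<dots>\<close>, so \<open>|n|\<close> grows like \<open>k / 2\<close>\<close>
    have "int k \<le> 2 * \<bar>?n\<bar>"
      by (auto simp: int_decode_def sum_decode_def split: sum.splits)
    then have "real k \<le> 2 * real_of_int \<bar>?n\<bar>" by linarith
    then have "real (Suc k) \<le> 1 + 2 * real_of_int \<bar>?n\<bar>" by simp
    then have "real (Suc k) ^ 2 \<le> (1 + 2 * real_of_int \<bar>?n\<bar>) ^ 2"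
      by (intro power_mono) auto
    also have "\<dots> \<le> 2 + 8 * real_of_int \<bar>?n\<bar> ^ 2"
      using sum_squares_ge_zero[of "1 - 2 * real_of_int \<bar>?n\<bar>" 0]
      by (simp add: power2_eq_square algebra_simps)
    finally have "norm (a ?n) * real (Suc k) ^ 2 \<le> norm (a ?n) * (2 + 8 * real_of_int \<bar>?n\<bar> ^ 2)"
      by (intro mult_left_mono) auto
    also have "\<dots> \<le> 2 * C + 8 * D"
      using C[of ?n] D[of ?n] by (simp add: algebra_simps)
    finally show "norm (norm (a ?n)) \<le> (2 * C + 8 * D) * inverse (real (Suc k) ^ 2)"
      by (simp add: pos_le_divide_eq flip: divide_inverse del: of_nat_Suc)
  qed
qed

context
  fixes a :: "int \<Rightarrow> complex"
  assumes a: "rapidly_decreasing a"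
begin

lemma trig_series_sums:
  "(\<lambda>k. a (int_decode k) * character (int_decode k) t) sums trig_series a t"
  unfolding trig_series_def
  by (rule summable_sums, rule summable_norm_cancel)
     (use rapidly_decreasing_summable[OF a] in \<open>simp add: norm_mult\<close>)

lemma norm_trig_series_le: "norm (trig_series a t) \<le> (\<Sum>k. norm (a (int_decode k)))"
  unfolding trig_series_def
  using summable_norm[of "\<lambda>k. a (int_decode k) * character (int_decode k) t"]
    rapidly_decreasing_summable[OF a] by (simp add: norm_mult)

lemma trig_series_has_vector_derivative:
  "(trig_series a has_vector_derivative trig_series (\<lambda>n. \<i> * of_int n * a n) t) (at t)"
proof -
  define b where "b n = \<i> * of_int n * a n" for n
  have b: "rapidly_decreasing b"
    unfolding b_def by (rule rapidly_decreasing_mult_freq[OF a])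
  have unif: "uniform_limit UNIV (\<lambda>N x. \<Sum>k<N. b (int_decode k) * character (int_decode k) x)
      (trig_series b) sequentially"
    unfolding trig_series_def[abs_def]
    by (rule Weierstrass_m_test[OF _ rapidly_decreasing_summable[OF b]]) (simp add: norm_mult)
  have "\<exists>g. \<forall>x\<in>UNIV. (\<lambda>k. a (int_decode k) * character (int_decode k) x) sums g x \<and>
      (g has_derivative (\<lambda>h. h *\<^sub>R trig_series b x)) (at x within UNIV)"
  proof (rule has_derivative_series)
    show "((\<lambda>x. a (int_decode k) * character (int_decode k) x) has_derivative
        (\<lambda>h. h *\<^sub>R (b (int_decode k) * character (int_decode k) x))) (at x within UNIV)" for k x
    proof -
      have "b (int_decode k) * character (int_decode k) x
          = a (int_decode k) * (\<i> * of_int (int_decode k) * character (int_decode k) x)"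
        by (simp add: b_def)
      then show ?thesis
        using has_vector_derivative_mult_right[OF character_has_vector_derivative[of "int_decode k" x],
          of "a (int_decode k)"]
        by (simp only: has_vector_derivative_def)
    qed
    show "\<forall>\<^sub>F N in sequentially. \<forall>x\<in>UNIV. \<forall>h. norm ((\<Sum>k<N. h *\<^sub>R (b (int_decode k) * character (int_decode k) x))
        - h *\<^sub>R trig_series b x) \<le> e * norm h" if "e > 0" for e
      using uniform_limitD[OF unif that]
    proof (eventually_elim, intro ballI allI)
      fix N x and h :: real
      assume "\<forall>x\<in>UNIV. dist (\<Sum>k<N. b (int_decode k) * character (int_decode k) x) (trig_series b x) < e"
      then have "norm ((\<Sum>k<N. b (int_decode k) * character (int_decode k) x) - trig_series b x) \<le> e"
        by (simp add: dist_norm less_imp_le)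
      then have "\<bar>h\<bar> * norm ((\<Sum>k<N. b (int_decode k) * character (int_decode k) x) - trig_series b x)
          \<le> \<bar>h\<bar> * e"
        by (intro mult_left_mono) auto
      moreover have "(\<Sum>k<N. h *\<^sub>R (b (int_decode k) * character (int_decode k) x)) - h *\<^sub>R trig_series b x
          = h *\<^sub>R ((\<Sum>k<N. b (int_decode k) * character (int_decode k) x) - trig_series b x)"
        by (simp add: scaleR_diff_right scaleR_right.sum)
      ultimately show "norm ((\<Sum>k<N. h *\<^sub>R (b (int_decode k) * character (int_decode k) x)) - h *\<^sub>R trig_series b x)
          \<le> e * norm h"
        by (simp only: norm_scaleR real_norm_def mult.commute[of e])
    qed
    show "(\<lambda>k. a (int_decode k) * character (int_decode k) 0) sums trig_series a 0"
      by (rule trig_series_sums)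
  qed auto
  then obtain g where g: "\<And>x. (\<lambda>k. a (int_decode k) * character (int_decode k) x) sums g x"
    "\<And>x. (g has_derivative (\<lambda>h. h *\<^sub>R trig_series b x)) (at x)" by auto
  have "g x = trig_series a x" for x
    by (rule sums_unique2[OF g(1) trig_series_sums])
  then have "g = trig_series a" by (rule ext)
  moreover have "b = (\<lambda>n. \<i> * of_int n * a n)"
    by (rule ext) (rule b_def)
  ultimately show ?thesis
    using g(2)[of t] by (simp only: has_vector_derivative_def)
qed

lemma ddt_trig_series: "ddt (trig_series a) = trig_series (\<lambda>n. \<i> * of_int n * a n)"
  by (rule ext) (rule vector_derivative_at[OF trig_series_has_vector_derivative])

end

lemma ddt_power_trig_series:
  "rapidly_decreasing a \<Longrightarrow> (ddt ^^ k) (trig_series a) = trig_series (\<lambda>n. (\<i> * of_int n) ^ k * a n)"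
proof (induction k)
  case (Suc k)
  then show ?case
    using ddt_trig_series[OF rapidly_decreasing_mult_freq_power[OF Suc.prems]] by (simp add: mult.assoc)
qed simp

lemma trig_series_smooth:
  assumes "rapidly_decreasing a"
  shows "trig_series a \<in> smooth_circle"
proof -
  have "periodic (trig_series a)"
    by (simp add: periodic_def trig_series_def character_periodic)
  moreover have "(ddt ^^ n) (trig_series a) differentiable (at t)" for n t
    unfolding ddt_power_trig_series[OF assms]
    by (rule differentiableI_vector[OF trig_series_has_vector_derivative])
       (rule rapidly_decreasing_mult_freq_power[OF assms])
  ultimately show ?thesis by (simp add: smooth_circle_def)
qed

lemma trig_series_sum:
  assumes "finite A" "\<And>j. j \<in> A \<Longrightarrow> rapidly_decreasing (a j)"
  shows "trig_series (\<lambda>n. \<Sum>j\<in>A. c j * a j n) t = (\<Sum>j\<in>A. c j * trig_series (a j) t)"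
proof -
  have "(\<lambda>k. \<Sum>j\<in>A. c j * (a j (int_decode k) * character (int_decode k) t)) sums
      (\<Sum>j\<in>A. c j * trig_series (a j) t)"
    by (intro sums_sum sums_mult trig_series_sums assms)
  then show ?thesis
    by (simp add: trig_series_def sums_unique[symmetric] sum_distrib_right mult.assoc)
qed

lemma poly_ddt_trig_series:
  assumes "rapidly_decreasing a"
  shows "poly_ddt P (trig_series a) = trig_series (\<lambda>n. poly P (\<i> * of_int n) * a n)"
proof
  fix t
  show "poly_ddt P (trig_series a) t = trig_series (\<lambda>n. poly P (\<i> * of_int n) * a n) t"
    using trig_series_sum[of "{..degree P}" "\<lambda>k n. (\<i> * of_int n) ^ k * a n" "coeff P" t]
    by (simp add: poly_ddt_def ddt_power_trig_series assms rapidly_decreasing_mult_freq_power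
      poly_altdef sum_distrib_right mult.assoc)
qed

lemma smooth_circle_has_vector_derivative:
  assumes "f \<in> smooth_circle"
  shows "(f has_vector_derivative ddt f t) (at t)"
proof -
  have "(ddt ^^ 0) f differentiable (at t)"
    using assms unfolding smooth_circle_def by blast
  then show ?thesis by (simp add: vector_derivative_works)
qed

lemma smooth_circle_continuous: "f \<in> smooth_circle \<Longrightarrow> continuous_on A f"
  using smooth_circle_has_vector_derivative
  by (blast intro: continuous_at_imp_continuous_on has_vector_derivative_continuous)

lemma smooth_circle_eq: "f \<in> smooth_circle \<Longrightarrow> circle_eq f f"
  using smooth_circle_continuous[of f UNIV]
  by (auto simp: circle_eq_def smooth_circle_def borel_measurable_continuous_onI)

lemma fourier_coeff_trig_series:
  assumes "rapidly_decreasing a"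
  shows "fourier_coeff (trig_series a) n = a n"
proof -
  let ?f = "\<lambda>k t. a (int_decode k) * character (int_decode k - n) t"
  have "(\<lambda>k. integral\<^sup>L circle_measure (?f k)) sums (LINT t|circle_measure. (\<Sum>k. ?f k t))"
  proof (rule sums_integral)
    show "integrable circle_measure (?f k)" for k
      by (intro integrable_circle_continuous continuous_intros continuous_on_character)
    show "summable (\<lambda>k. LINT t|circle_measure. norm (?f k t))"
      using rapidly_decreasing_summable[OF assms] circle.prob_space by (simp add: norm_mult)
  qed (use rapidly_decreasing_summable[OF assms] in \<open>simp add: norm_mult\<close>)
  moreover have "(\<Sum>k. ?f k t) = trig_series a t * character (- n) t" for t
    using sums_mult2[OF trig_series_sums[OF assms], of t "character (- n) t"] character_add[of _ "- n" t]
    by (simp add: sums_unique[symmetric] mult.assoc)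
  moreover have "integral\<^sup>L circle_measure (?f k) = (if k = int_encode n then a n else 0)" for k
    by (auto simp: integral_character)
  ultimately have "(\<lambda>k. if k = int_encode n then a n else 0) sums fourier_coeff (trig_series a) n"
    by (simp add: fourier_coeff_eq)
  then show ?thesis
    using sums_single[of "int_encode n" "\<lambda>_. a n"] by (auto intro: sums_unique2)
qed

lemma ddt_smooth:
  assumes "f \<in> smooth_circle"
  shows "ddt f \<in> smooth_circle"
proof -
  note d = smooth_circle_has_vector_derivative[OF assms]
  have "ddt f (t + 2 * pi) = ddt f t" for t
  proof (rule vector_derivative_at[symmetric])
    have "((f \<circ> (\<lambda>t. t + 2 * pi)) has_vector_derivative 1 *\<^sub>R ddt f (t + 2 * pi)) (at t)"
      by (intro vector_diff_chain_at) (auto intro!: derivative_eq_intros d)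
    moreover have "f \<circ> (\<lambda>t. t + 2 * pi) = f"
      using assms by (auto simp: smooth_circle_def periodic_def)
    ultimately show "(f has_vector_derivative ddt f (t + 2 * pi)) (at t)" by simp
  qed
  moreover have "(ddt ^^ n) (ddt f) differentiable (at t)" for n t
    using assms by (simp add: smooth_circle_def flip: funpow_Suc_right[unfolded comp_def] funpow_swap1)
      (metis comp_apply funpow_Suc_right)
  ultimately show ?thesis
    by (simp add: smooth_circle_def periodic_def)
qed

text \<open>
  Integration by parts: the derivative of the periodic function \<open>f(t) e\<^sup>-\<^sup>i\<^sup>n\<^sup>t\<close> integrates to zero.
\<close>

lemma fourier_coeff_ddt:
  assumes "f \<in> smooth_circle"
  shows "fourier_coeff (ddt f) n = \<i> * of_int n * fourier_coeff f n"
proof -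
  note d = smooth_circle_has_vector_derivative[OF assms]
  have c: "continuous_on UNIV f" "continuous_on UNIV (ddt f)"
    using assms ddt_smooth smooth_circle_continuous by blast+
  let ?g = "\<lambda>t. f t * (\<i> * of_int (- n) * character (- n) t) + ddt f t * character (- n) t"
  have "(LINT t|circle_measure. ?g t) = 0"
  proof (rule integral_circle_vector_derivative)
    show "((\<lambda>t. f t * character (- n) t) has_vector_derivative ?g t) (at t)" for t
      by (intro has_vector_derivative_mult d character_has_vector_derivative)
    show "f (2 * pi) * character (- n) (2 * pi) = f 0 * character (- n) 0"
      using character_periodic[of "-n" 0] assms by (simp add: smooth_circle_def periodic_def) (metis add_0)
  qed (intro continuous_intros c continuous_on_character)
  moreover have "(LINT t|circle_measure. ?g t) = - (\<i> * of_int n) * fourier_coeff f n + fourier_coeff (ddt f) n"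
  proof -
    have "?g t = - (\<i> * of_int n) * (f t * character (- n) t) + ddt f t * character (- n) t" for t
      by simp
    then show ?thesis
      unfolding fourier_coeff_eq
      by (simp only:) (subst Bochner_Integration.integral_add,
        auto intro!: integrable_mult_character integrable_circle_continuous c
          continuous_intros continuous_on_character)
  qed
  ultimately show ?thesis by simp
qed

text \<open>
  \<open>|n|\<^sup>m |c\<^sub>n(f)|\<close> is the modulus of a coefficient of the \<open>m\<close>-th derivative of \<open>f\<close>, hence at most its
  \<open>L\<^sup>1\<close> norm.
\<close>

lemma rapidly_decreasing_fourier_coeff:
  assumes "f \<in> smooth_circle"
  shows "rapidly_decreasing (fourier_coeff f)"
  unfolding rapidly_decreasing_def
proof
  fix m
  have "(ddt ^^ m) f \<in> smooth_circle \<and>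
      (\<forall>n. fourier_coeff ((ddt ^^ m) f) n = (\<i> * of_int n) ^ m * fourier_coeff f n)"
    by (induction m) (use assms in \<open>auto simp: ddt_smooth fourier_coeff_ddt mult.assoc\<close>)
  then have "real_of_int \<bar>n\<bar> ^ m * norm (fourier_coeff f n) \<le> (LINT t|circle_measure. norm ((ddt ^^ m) f t))" for n
    using norm_fourier_coeff_le[of "(ddt ^^ m) f" n] by (simp add: norm_mult norm_power)
  then show "\<exists>C. \<forall>n. real_of_int \<bar>n\<bar> ^ m * norm (fourier_coeff f n) \<le> C" by blast
qed

text \<open>
  This makes the smooth representative of a class unique.
\<close>

lemma continuous_periodic_eqI:
  assumes f: "continuous_on UNIV f" "periodic f" and g: "continuous_on UNIV g" "periodic g"
    and AE: "AE t in circle_measure. f t = g t"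
  shows "f = g"
proof
  let ?C = "{t. f t = g t}"
  have C: "closed ?C" by (intro closed_Collect_eq f g)
  have "AE t in lebesgue. t \<in> {0<..<2*pi} \<longrightarrow> t \<in> ?C"
    using AE by (intro AE_completion) (auto simp: AE_circle_measure elim: eventually_mono)
  then have "{0<..<2*pi} \<subseteq> ?C"
    using mem_closed_if_AE_lebesgue_open[OF _ C, of "{0<..<2*pi}"] by auto
  then have *: "{0..2*pi} \<subseteq> ?C"
    using closure_minimal[OF _ C, of "{0<..<2*pi}"] by simp
  have per: "h (t + of_int k * (2 * pi)) = h t" if "periodic h" for h :: "real \<Rightarrow> complex" and k t
  proof (induction k rule: int_induct[of _ 0])
    case (step1 k)
    have "h (t + of_int k * (2 * pi) + 2 * pi) = h (t + of_int k * (2 * pi))"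
      using that by (simp only: periodic_def)
    with step1 show ?case by (simp add: algebra_simps)
  next
    case (step2 k)
    have "h (t + of_int (k - 1) * (2 * pi) + 2 * pi) = h (t + of_int (k - 1) * (2 * pi))"
      using that by (simp only: periodic_def)
    with step2 show ?case by (simp add: algebra_simps)
  qed simp
  fix t
  define k where "k = \<lfloor>t / (2 * pi)\<rfloor>"
  have "of_int k \<le> t / (2 * pi)" "t / (2 * pi) \<le> of_int k + 1"
    by (simp_all add: k_def)
  then have "t + of_int (- k) * (2 * pi) \<in> {0..2*pi}"
    by (simp add: field_simps)
  then have "f (t + of_int (- k) * (2 * pi)) = g (t + of_int (- k) * (2 * pi))"
    using * by blast
  then show "f t = g t"
    by (simp only: per f g)
qed

text \<open>
  A smooth function and its Fourier series are continuous with equal coefficients, so uniqueness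
  of the coefficients gives pointwise equality.
\<close>

lemma smooth_eq_trig_series:
  assumes "f \<in> smooth_circle"
  shows "trig_series (fourier_coeff f) = f"
proof -
  let ?g = "trig_series (fourier_coeff f)"
  have g: "?g \<in> smooth_circle"
    by (intro trig_series_smooth rapidly_decreasing_fourier_coeff assms)
  note c = smooth_circle_continuous[OF g, of UNIV] smooth_circle_continuous[OF assms, of UNIV]
  have "AE t in circle_measure. ?g t - f t = 0"
    using rapidly_decreasing_fourier_coeff[OF assms] c
    by (intro fourier_coeff_unique)
       (simp_all add: integrable_circle_continuous fourier_coeff_diff fourier_coeff_trig_series)
  then show ?thesis
    using c g assms by (intro continuous_periodic_eqI) (auto simp: smooth_circle_def)
qed

lemma trig_series_diff:
  assumes "rapidly_decreasing a" "rapidly_decreasing b"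
  shows "trig_series (\<lambda>n. a n - b n) t = trig_series a t - trig_series b t"
  using sums_diff[OF trig_series_sums[OF assms(1), of t] trig_series_sums[OF assms(2), of t]]
  by (simp add: trig_series_def[of "\<lambda>n. a n - b n"] left_diff_distrib sums_iff)

lemma trig_series_cmult:
  assumes "rapidly_decreasing a"
  shows "trig_series (\<lambda>n. c * a n) t = c * trig_series a t"
  using sums_mult[OF trig_series_sums[OF assms, of t], of c]
  by (simp add: trig_series_def[of "\<lambda>n. c * a n"] mult.assoc sums_iff)

lemma rapidly_decreasing_diff:
  "rapidly_decreasing a \<Longrightarrow> rapidly_decreasing b \<Longrightarrow> rapidly_decreasing (\<lambda>n. a n - b n)"
  using rapidly_decreasing_add[of a "\<lambda>n. - 1 * b n"] rapidly_decreasing_cmult[of b "- 1"] by simp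

lemma rapidly_decreasing_delta: "rapidly_decreasing (\<lambda>k. if k = m then c else 0)"
  unfolding rapidly_decreasing_def
proof (intro allI exI)
  fix j k
  show "real_of_int \<bar>k\<bar> ^ j * norm (if k = m then c else 0) \<le> real_of_int \<bar>m\<bar> ^ j * norm c"
    by simp
qed

lemma trig_series_delta: "trig_series (\<lambda>k. if k = m then c else 0) t = c * character m t"
proof -
  have "(\<lambda>k. (if int_decode k = m then c else 0) * character (int_decode k) t)
      = (\<lambda>k. if k = int_encode m then c * character m t else 0)"
    by (auto simp: fun_eq_iff)
  then show ?thesis
    using sums_single[of "int_encode m" "\<lambda>_. c * character m t"]
    by (simp add: trig_series_def sums_iff)
qed

text \<open>
  Through this map, calculations with smooth elements of \<open>L\<^sup>p\<close> become calculations with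
  coefficient sequences.
\<close>

definition trig_class :: "(int \<Rightarrow> complex) \<Rightarrow> circle_fun" where
  "trig_class a = abs_circle_fun (trig_series a)"

lemma circle_eq_trig_series: "rapidly_decreasing a \<Longrightarrow> circle_eq (trig_series a) (trig_series a)"
  by (intro smooth_circle_eq trig_series_smooth)

lemma trig_class_diff:
  "rapidly_decreasing a \<Longrightarrow> rapidly_decreasing b \<Longrightarrow>
    trig_class a - trig_class b = trig_class (\<lambda>n. a n - b n)"
  by (simp add: trig_class_def minus_circle_fun.abs_eq circle_eq_trig_series flip: trig_series_diff)

lemma trig_class_cmult:
  "rapidly_decreasing a \<Longrightarrow> c *\<^sub>C trig_class a = trig_class (\<lambda>n. c * a n)"
  by (simp add: trig_class_def scaleC_circle_fun.abs_eq circle_eq_trig_series flip: trig_series_cmult)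

lemma fourier_coeff_trig_class:
  "rapidly_decreasing a \<Longrightarrow> fourier_coeff (rep_circle_fun (trig_class a)) n = a n"
  by (simp add: trig_class_def fourier_coeff_rep_abs circle_eq_trig_series fourier_coeff_trig_series)

lemma trig_class_Lp:
  assumes "1 \<le> p" "rapidly_decreasing a"
  shows "trig_class a \<in> Lp p" "Lp_norm p (trig_class a) \<le> (\<Sum>k. norm (a (int_decode k)))"
  unfolding trig_class_def
  by (intro Lp_bounded[OF assms(1) circle_eq_trig_series norm_trig_series_le] assms(2))+

lemma Lp_norm_trig_class_le:
  assumes p: "1 \<le> p" and a: "rapidly_decreasing a" and le: "\<And>n. norm (b n) \<le> K * norm (a n)"
  shows "Lp_norm p (trig_class b) \<le> K * (\<Sum>k. norm (a (int_decode k)))"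
proof -
  have b: "rapidly_decreasing b"
    using a le by (rule rapidly_decreasing_le)
  have "Lp_norm p (trig_class b) \<le> (\<Sum>k. norm (b (int_decode k)))"
    by (rule trig_class_Lp[OF p b])
  also have "\<dots> \<le> (\<Sum>k. K * norm (a (int_decode k)))"
    by (intro suminf_le le rapidly_decreasing_summable b summable_mult a)
  also have "\<dots> = K * (\<Sum>k. norm (a (int_decode k)))"
    by (intro suminf_mult rapidly_decreasing_summable a)
  finally show ?thesis .
qed

section \<open>Differential operators act on Fourier coefficients\<close>

text \<open>
  The test function is \<open>g = e\<^sup>-\<^sup>i\<^sup>n\<^sup>t\<close>: since \<open>P(-d/dt) g = P(in) g\<close>, the definition of the
  distributional image becomes the asserted equation.
\<close>

lemma distr_image_fourier_coeff:
  assumes "distr_image P F H"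
  shows "fourier_coeff (rep_circle_fun H) n = poly P (\<i> * of_int n) * fourier_coeff (rep_circle_fun F) n"
proof -
  let ?a = "\<lambda>k. if k = - n then 1 else 0 :: complex"
  let ?Q = "P \<circ>\<^sub>p [:0, - 1:]"
  have g: "trig_series ?a = character (- n)"
    by (rule ext) (simp add: trig_series_delta)
  have "poly_ddt ?Q (character (- n)) = trig_series (\<lambda>k. poly ?Q (\<i> * of_int k) * ?a k)"
    unfolding g[symmetric] by (rule poly_ddt_trig_series[OF rapidly_decreasing_delta])
  also have "(\<lambda>k. poly ?Q (\<i> * of_int k) * ?a k) = (\<lambda>k. if k = - n then poly P (\<i> * of_int n) else 0)"
    by (auto simp: fun_eq_iff poly_pcompose)
  finally have "poly_ddt ?Q (character (- n)) t = poly P (\<i> * of_int n) * character (- n) t" for t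
    by (simp add: trig_series_delta)
  moreover have "character (- n) \<in> smooth_circle"
    unfolding g[symmetric] by (rule trig_series_smooth[OF rapidly_decreasing_delta])
  ultimately have "fourier_coeff (rep_circle_fun H) n
      = (LINT t|circle_measure. rep_circle_fun F t * (poly P (\<i> * of_int n) * character (- n) t))"
    using assms by (simp add: distr_image_def fourier_coeff_eq)
  also have "\<dots> = (LINT t|circle_measure. poly P (\<i> * of_int n) * (rep_circle_fun F t * character (- n) t))"
    by (simp only: mult.left_commute)
  finally show ?thesis
    by (simp add: fourier_coeff_eq)
qed

text \<open>
  The definite description in \<open>Tc_op\<close> is justified because the distributional image has prescribed
  Fourier coefficients.
\<close>

lemma Tc_op_SomeD:
  assumes p: "1 \<le> p" and Some: "Tc_op p P F = Some H"
  shows "F \<in> Lp p" "H \<in> Lp p" "distr_image P F H"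
proof -
  from Some have F: "F \<in> Lp p" and ex: "\<exists>H\<in>Lp p. distr_image P F H"
    and H: "H = (THE H. H \<in> Lp p \<and> distr_image P F H)"
    by (auto simp: Tc_op_def split: if_splits)
  have "\<exists>!H. H \<in> Lp p \<and> distr_image P F H"
    using ex by (auto intro: Lp_eqI[OF p] simp: distr_image_fourier_coeff)
  from theI'[OF this] F show "F \<in> Lp p" "H \<in> Lp p" "distr_image P F H"
    by (simp_all add: H)
qed

text \<open>
  The description in \<open>T_op\<close> picks out \<open>trig_series a\<close> as the only smooth representative.
\<close>

lemma T_op_trig_class:
  assumes "rapidly_decreasing a"
  shows "T_op P (trig_class a) = Some (trig_class (\<lambda>n. poly P (\<i> * of_int n) * a n))"
proof -
  have s: "trig_series a \<in> smooth_circle"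
    by (rule trig_series_smooth[OF assms])
  have "(THE f. f \<in> smooth_circle \<and> abs_circle_fun f = trig_class a) = trig_series a"
  proof (rule the_equality)
    fix f
    assume "f \<in> smooth_circle \<and> abs_circle_fun f = trig_class a"
    then have f: "f \<in> smooth_circle" and "AE t in circle_measure. f t = trig_series a t"
      using s by (auto simp: trig_class_def abs_circle_fun_eq_iff smooth_circle_eq)
    then show "f = trig_series a"
      using s by (intro continuous_periodic_eqI smooth_circle_continuous) (auto simp: smooth_circle_def)
  qed (use s in \<open>simp add: trig_class_def\<close>)
  moreover have "trig_class a \<in> abs_circle_fun ` smooth_circle"
    using s by (auto simp: trig_class_def)
  ultimately show ?thesis
    by (simp add: T_op_def poly_ddt_trig_series[OF assms]) (simp add: trig_class_def)
qed

lemma trig_class_fourier_coeff: "f \<in> smooth_circle \<Longrightarrow> trig_class (fourier_coeff f) = abs_circle_fun f"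
  by (simp add: trig_class_def smooth_eq_trig_series)

section \<open>Local spectral theory of the extensions\<close>

locale differential_operator_extension =
  fixes p :: ereal and P :: "complex poly" and Te :: "circle_fun \<rightharpoonup> circle_fun"
  assumes p: "1 \<le> p" and extends_T: "T_op P \<subseteq>\<^sub>m Te" and extended_by_Tc: "Te \<subseteq>\<^sub>m Tc_op p P"
begin

lemma Te_trig_class:
  assumes "rapidly_decreasing a"
  shows "Te (trig_class a) = Some (trig_class (\<lambda>n. poly P (\<i> * of_int n) * a n))"
  using extends_T T_op_trig_class[OF assms, of P] unfolding map_le_def by (metis domI)

lemma op_power_trig_class:
  assumes "rapidly_decreasing a"
  shows "rapidly_decreasing (\<lambda>n. poly P (\<i> * of_int n) ^ k * a n) \<and>
    op_power Te k (trig_class a) = Some (trig_class (\<lambda>n. poly P (\<i> * of_int n) ^ k * a n))"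
proof (induction k)
  case 0
  show ?case by (simp add: op_power_def assms)
next
  case (Suc k)
  let ?b = "\<lambda>n. poly P (\<i> * of_int n) ^ k * a n"
  have "op_power Te (Suc k) (trig_class a) = Te (trig_class ?b)"
    using Suc by (simp add: op_power_def map_comp_def)
  then show ?case
    using Suc Te_trig_class[of ?b] rapidly_decreasing_mult_poly[of ?b P] by (simp add: mult.assoc)
qed

lemma Te_dom:
  assumes "F \<in> dom Te"
  shows "F \<in> Lp p" "the (Te F) \<in> Lp p"
    "fourier_coeff (rep_circle_fun (the (Te F))) n = poly P (\<i> * of_int n) * fourier_coeff (rep_circle_fun F) n"
proof -
  have "Tc_op p P F = Some (the (Te F))"
    using assms extended_by_Tc by (force simp: map_le_def)
  from Tc_op_SomeD[OF p this] show "F \<in> Lp p" "the (Te F) \<in> Lp p"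
    "fourier_coeff (rep_circle_fun (the (Te F))) n = poly P (\<i> * of_int n) * fourier_coeff (rep_circle_fun F) n"
    by (auto intro: distr_image_fourier_coeff)
qed

lemma resolvent_solution_fourier_coeff:
  assumes "resolvent_solution (Lp p) (Lp_norm p) Te F U \<phi>" "z \<in> U"
  shows "(poly P (\<i> * of_int n) - z) * fourier_coeff (rep_circle_fun (\<phi> z)) n = fourier_coeff (rep_circle_fun F) n"
proof -
  from assms have d: "\<phi> z \<in> dom Te" and F: "the (Te (\<phi> z)) - z *\<^sub>C \<phi> z = F"
    by (auto simp: resolvent_solution_def)
  show ?thesis
    unfolding F[symmetric] using Te_dom[OF d] p
    by (simp add: fourier_coeff_rep_minus[OF p] Lp_scaleC fourier_coeff_rep_scaleC left_diff_distrib)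
qed

end

text \<open>
  A Fourier coefficient is a bounded functional on \<open>L\<^sup>p\<close>, so it maps the norm convergent difference
  quotients of \<open>\<phi>\<close> to convergent difference quotients.
\<close>

lemma analytic_into_isCont_fourier_coeff:
  assumes p: "1 \<le> p" and U: "open U" "z \<in> U" and an: "analytic_into (Lp p) (Lp_norm p) U \<phi>"
  shows "isCont (\<lambda>w. fourier_coeff (rep_circle_fun (\<phi> w)) n) z"
proof -
  let ?c = "\<lambda>F. fourier_coeff (rep_circle_fun F) n"
  from an U obtain d where d: "d \<in> Lp p"
    and lim: "((\<lambda>w. Lp_norm p (inverse (w - z) *\<^sub>C (\<phi> w - \<phi> z) - d)) \<longlongrightarrow> 0) (at z)"
    by (auto simp: analytic_into_def)
  have \<phi>: "\<phi> w \<in> Lp p" if "w \<in> U" for w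
    using an that by (auto simp: analytic_into_def)
  have "\<forall>\<^sub>F w in at z. w \<in> U"
    using U by (intro eventually_at_in_open')
  then have "\<forall>\<^sub>F w in at z. norm ((?c (\<phi> w) - ?c (\<phi> z)) / (w - z) - ?c d)
      \<le> Lp_norm p (inverse (w - z) *\<^sub>C (\<phi> w - \<phi> z) - d)"
  proof eventually_elim
    case (elim w)
    let ?G = "inverse (w - z) *\<^sub>C (\<phi> w - \<phi> z)"
    have G: "?G \<in> Lp p"
      by (intro Lp_scaleC Lp_minus p \<phi> elim U)
    have "?c (?G - d) = (?c (\<phi> w) - ?c (\<phi> z)) / (w - z) - ?c d"
      unfolding fourier_coeff_rep_minus[OF p G d] fourier_coeff_rep_scaleC
        fourier_coeff_rep_minus[OF p \<phi>[OF elim] \<phi>[OF U(2)]]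
      by (simp add: divide_inverse mult.commute)
    then show ?case
      using norm_fourier_coeff_le_Lp_norm[OF p Lp_minus[OF p G d], of n] by simp
  qed
  then have "((\<lambda>w. (?c (\<phi> w) - ?c (\<phi> z)) / (w - z) - ?c d) \<longlongrightarrow> 0) (at z)"
    using lim by (rule Lim_null_comparison)
  then have "((\<lambda>w. ?c (\<phi> w)) has_field_derivative ?c d) (at z)"
    unfolding has_field_derivative_iff by (rule LIM_zero_cancel)
  then show ?thesis by (rule DERIV_isCont)
qed

context differential_operator_extension
begin

text \<open>
  At \<open>z = P(in)\<close> the equation for the \<open>n\<close>-th coefficient is void; continuity in \<open>z\<close> supplies the value.
\<close>

theorem SVEP: "has_SVEP (Lp p) (Lp_norm p) Te"
  unfolding has_SVEP_def
proof (intro allI impI ballI; elim conjE)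
  fix U \<phi> z
  assume U: "open U" "z \<in> U" and res: "resolvent_solution (Lp p) (Lp_norm p) Te 0 U \<phi>"
  have an: "analytic_into (Lp p) (Lp_norm p) U \<phi>"
    using res by (simp add: resolvent_solution_def)
  have "fourier_coeff (rep_circle_fun (\<phi> z)) n = 0" for n
  proof -
    let ?c = "\<lambda>w. fourier_coeff (rep_circle_fun (\<phi> w)) n" and ?q = "poly P (\<i> * of_int n)"
    have zero: "?c w = 0" if "w \<in> U" "w \<noteq> ?q" for w
      using resolvent_solution_fourier_coeff[OF res that(1), of n] that(2)
      by (simp add: fourier_coeff_rep_zero)
    show ?thesis
    proof (cases "z = ?q")
      case True
      have "\<forall>\<^sub>F w in at z. w \<in> U \<and> w \<noteq> z"
        using U eventually_at_in_open[of U z] by auto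
      then have "\<forall>\<^sub>F w in at z. ?c w = 0"
        by eventually_elim (use zero True in auto)
      then have "(?c \<longlongrightarrow> 0) (at z)"
        by (rule tendsto_eventually)
      moreover have "(?c \<longlongrightarrow> ?c z) (at z)"
        using analytic_into_isCont_fourier_coeff[OF p U an] by (rule isContD)
      ultimately show ?thesis
        by (rule tendsto_unique[OF trivial_limit_at, symmetric])
    qed (use zero U in auto)
  qed
  then show "\<phi> z = 0"
    using an U by (intro Lp_eqI[OF p] Lp_zero[OF p])
      (auto simp: analytic_into_def fourier_coeff_rep_zero)
qed

lemma closed_local_spectrum: "closed (local_spectrum X N S x)"
proof -
  have "local_resolvent_set X N S x = \<Union>{U. open U \<and> (\<exists>\<phi>. resolvent_solution X N S x U \<phi>)}"
    by (auto simp: local_resolvent_set_def)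
  then have "open (local_resolvent_set X N S x)"
    by (simp add: open_Union)
  then show ?thesis by (simp add: local_spectrum_def closed_Compl)
qed

lemma spectrum_subset_local_spectrum:
  assumes a: "rapidly_decreasing a"
  shows "closure {poly P (\<i> * of_int n) |n. a n \<noteq> 0} \<subseteq> local_spectrum (Lp p) (Lp_norm p) Te (trig_class a)"
proof (rule closure_minimal[OF _ closed_local_spectrum], safe)
  fix n
  assume "a n \<noteq> 0"
  show "poly P (\<i> * of_int n) \<in> local_spectrum (Lp p) (Lp_norm p) Te (trig_class a)"
    unfolding local_spectrum_def local_resolvent_set_def
  proof (clarsimp)
    fix U \<phi>
    assume "poly P (\<i> * of_int n) \<in> U" "resolvent_solution (Lp p) (Lp_norm p) Te (trig_class a) U \<phi>"
    from resolvent_solution_fourier_coeff[OF this(2,1), of n] show False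
      using \<open>a n \<noteq> 0\<close> by (simp add: fourier_coeff_trig_class a)
  qed
qed

text \<open>
  The solution is smooth since dividing \<open>a\<^sub>n \<noteq> 0\<close> by \<open>P(in) - z\<close>, of modulus at least \<open>\<delta>\<close>, preserves rapid
  decrease.
  Its derivative has coefficients \<open>a\<^sub>n / (P(in) - z)\<^sup>2\<close>: the difference quotient between \<open>w\<close> and \<open>z\<close>
  differs from it by the series with coefficients \<open>(w - z) a\<^sub>n / ((P(in) - w) (P(in) - z)\<^sup>2)\<close>, whose norm is
  at most \<open>|w - z| \<delta>\<^sup>-\<^sup>3 \<Sum> |a\<^sub>n|\<close>.
  Where \<open>a\<^sub>n = 0\<close> the denominator may vanish; the quotient is then \<open>0\<close>, as it should be.
\<close>

lemma resolvent_series: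
  assumes a: "rapidly_decreasing a" and "open U" "\<delta> > 0"
    and far: "\<And>z n. z \<in> U \<Longrightarrow> a n \<noteq> 0 \<Longrightarrow> \<delta> \<le> norm (poly P (\<i> * of_int n) - z)"
  shows "resolvent_solution (Lp p) (Lp_norm p) Te (trig_class a) U
    (\<lambda>z. trig_class (\<lambda>n. a n / (poly P (\<i> * of_int n) - z)))"
proof -
  define q where "q n = poly P (\<i> * of_int n)" for n
  note far = far[folded q_def]
  let ?\<phi> = "\<lambda>z. trig_class (\<lambda>n. a n / (q n - z))"
  have le1: "norm (a n / (q n - z)) \<le> 1 / \<delta> * norm (a n)" if "z \<in> U" for z n
    using far[OF that, of n] \<open>\<delta> > 0\<close> by (cases "a n = 0") (auto simp: norm_divide frac_le)
  have le2: "norm (a n / (q n - z) ^ 2) \<le> 1 / \<delta> ^ 2 * norm (a n)" if "z \<in> U" for z n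
    using far[OF that, of n] \<open>\<delta> > 0\<close>
    by (cases "a n = 0") (auto simp: norm_divide norm_power intro!: frac_le power_mono)
  have le3: "norm ((w - z) * (a n / ((q n - w) * (q n - z) ^ 2))) \<le> norm (w - z) / \<delta> ^ 3 * norm (a n)"
    if "w \<in> U" "z \<in> U" for w z n
  proof (cases "a n = 0")
    case False
    have "\<delta> ^ 3 \<le> norm (q n - w) * norm (q n - z) ^ 2"
      using mult_mono[OF far[OF that(1) False] power_mono[OF far[OF that(2) False], of 2]] \<open>\<delta> > 0\<close>
      by (simp add: power3_eq_cube power2_eq_square mult.assoc)
    then have "norm (w - z) * norm (a n) / (norm (q n - w) * norm (q n - z) ^ 2) \<le> norm (w - z) * norm (a n) / \<delta> ^ 3"
      using \<open>\<delta> > 0\<close> by (intro frac_le) auto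
    then show ?thesis by (simp add: norm_mult norm_divide norm_power)
  qed simp
  have r1: "rapidly_decreasing (\<lambda>n. a n / (q n - z))" if "z \<in> U" for z
    by (rule rapidly_decreasing_le[OF a le1[OF that]])
  have r2: "rapidly_decreasing (\<lambda>n. a n / (q n - z) ^ 2)" if "z \<in> U" for z
    by (rule rapidly_decreasing_le[OF a le2[OF that]])
  have ne: "q n - z \<noteq> 0" if "z \<in> U" "a n \<noteq> 0" for z n
    using far[OF that] \<open>\<delta> > 0\<close> by auto
  have "((\<lambda>w. Lp_norm p (inverse (w - z) *\<^sub>C (?\<phi> w - ?\<phi> z) - trig_class (\<lambda>n. a n / (q n - z) ^ 2))) \<longlongrightarrow> 0) (at z)"
    if z: "z \<in> U" for z
  proof (rule Lim_null_comparison)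
    let ?M = "\<Sum>k. norm (a (int_decode k))"
    have "\<forall>\<^sub>F w in at z. w \<in> U \<and> w \<noteq> z"
      using z \<open>open U\<close> eventually_at_in_open[of U z] by auto
    then show "\<forall>\<^sub>F w in at z. norm (Lp_norm p (inverse (w - z) *\<^sub>C (?\<phi> w - ?\<phi> z) - trig_class (\<lambda>n. a n / (q n - z) ^ 2)))
        \<le> norm (w - z) / \<delta> ^ 3 * ?M"
    proof eventually_elim
      case (elim w)
      then have w: "w \<in> U" "w \<noteq> z" by auto
      let ?D = "\<lambda>n. inverse (w - z) * (a n / (q n - w) - a n / (q n - z)) - a n / (q n - z) ^ 2"
      have D: "inverse (w - z) *\<^sub>C (?\<phi> w - ?\<phi> z) - trig_class (\<lambda>n. a n / (q n - z) ^ 2) = trig_class ?D"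
        using r1[OF w(1)] r1[OF z] r2[OF z]
        by (simp only: trig_class_diff trig_class_cmult rapidly_decreasing_diff rapidly_decreasing_cmult)
      have r: "rapidly_decreasing ?D"
        by (intro rapidly_decreasing_diff rapidly_decreasing_cmult r1 r2 w z)
      have "?D n = (w - z) * (a n / ((q n - w) * (q n - z) ^ 2))" for n
      proof (cases "a n = 0")
        case False
        have "inverse (w - z) * (a n / (q n - w) - a n / (q n - z)) = a n / ((q n - w) * (q n - z))"
          using ne[OF w(1) False] ne[OF z False] w(2) by (simp add: divide_simps) (simp add: algebra_simps)
        moreover have "a n / ((q n - w) * (q n - z)) - a n / (q n - z) ^ 2
            = (w - z) * (a n / ((q n - w) * (q n - z) ^ 2))"
          using ne[OF w(1) False] ne[OF z False]
          by (simp add: divide_simps power2_eq_square) (simp add: algebra_simps)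
        ultimately show ?thesis by simp
      qed simp
      then have "norm (?D n) \<le> norm (w - z) / \<delta> ^ 3 * norm (a n)" for n
        using le3[OF w(1) z, of n] by simp
      from Lp_norm_trig_class_le[OF p a this] show ?case
        unfolding D using Lp_norm_nonneg[OF p trig_class_Lp(1)[OF p r]] by simp
    qed
    have "((\<lambda>w. norm (w - z) / \<delta> ^ 3 * ?M) \<longlongrightarrow> norm (z - z) / \<delta> ^ 3 * ?M) (at z)"
      using \<open>\<delta> > 0\<close> by (intro tendsto_intros) auto
    then show "((\<lambda>w. norm (w - z) / \<delta> ^ 3 * ?M) \<longlongrightarrow> 0) (at z)" by simp
  qed
  then have "analytic_into (Lp p) (Lp_norm p) U ?\<phi>"
    unfolding analytic_into_def using trig_class_Lp(1)[OF p] r1 r2 by blast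
  moreover have "?\<phi> z \<in> dom Te \<and> the (Te (?\<phi> z)) - z *\<^sub>C ?\<phi> z = trig_class a" if z: "z \<in> U" for z
  proof -
    have T: "Te (?\<phi> z) = Some (trig_class (\<lambda>n. q n * (a n / (q n - z))))"
      unfolding q_def by (rule Te_trig_class[OF r1[OF z, unfolded q_def]])
    have "rapidly_decreasing (\<lambda>n. q n * (a n / (q n - z)))"
      unfolding q_def by (rule rapidly_decreasing_mult_poly[OF r1[OF z, unfolded q_def]])
    then have "the (Te (?\<phi> z)) - z *\<^sub>C ?\<phi> z = trig_class (\<lambda>n. q n * (a n / (q n - z)) - z * (a n / (q n - z)))"
      using r1[OF z] by (simp only: T option.sel trig_class_cmult trig_class_diff rapidly_decreasing_cmult)
    also have "(\<lambda>n. q n * (a n / (q n - z)) - z * (a n / (q n - z))) = a"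
    proof
      fix n
      have "q n * (a n / (q n - z)) - z * (a n / (q n - z)) = (q n - z) * (a n / (q n - z))"
        by (rule left_diff_distrib[symmetric])
      then show "q n * (a n / (q n - z)) - z * (a n / (q n - z)) = a n"
        using ne[OF z, of n] by (cases "a n = 0") simp_all
    qed
    finally have "the (Te (?\<phi> z)) - z *\<^sub>C ?\<phi> z = trig_class a" .
    then show ?thesis using T by blast
  qed
  ultimately show ?thesis
    unfolding resolvent_solution_def q_def by blast
qed

text \<open>
  A point at distance \<open>e\<close> from the closure has the ball of radius \<open>e / 2\<close> as a neighbourhood on
  which the resolvent series converges with \<open>\<delta> = e / 2\<close>.
\<close>

theorem local_spectrum_trig_class:
  assumes a: "rapidly_decreasing a"
  shows "local_spectrum (Lp p) (Lp_norm p) Te (trig_class a) = closure {poly P (\<i> * of_int n) |n. a n \<noteq> 0}"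
proof
  let ?S = "{poly P (\<i> * of_int n) |n. a n \<noteq> 0}"
  show "local_spectrum (Lp p) (Lp_norm p) Te (trig_class a) \<subseteq> closure ?S"
  proof
    fix z
    assume z: "z \<in> local_spectrum (Lp p) (Lp_norm p) Te (trig_class a)"
    show "z \<in> closure ?S"
    proof (rule ccontr)
      assume "z \<notin> closure ?S"
      then have "z \<in> - closure ?S"
        by simp
      moreover have "open (- closure ?S)"
        by (intro open_Compl closed_closure)
      ultimately obtain e where e: "e > 0" "ball z e \<subseteq> - closure ?S"
        by (meson open_contains_ball)
      have "e / 2 \<le> norm (poly P (\<i> * of_int n) - w)" if "w \<in> ball z (e / 2)" "a n \<noteq> 0" for w n
      proof -
        have "poly P (\<i> * of_int n) \<in> closure ?S"
          using that(2) closure_subset[of ?S] by blast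
        then have "e \<le> dist z (poly P (\<i> * of_int n))"
          using e(2) by (force simp: not_less[symmetric])
        also have "\<dots> \<le> dist z w + dist w (poly P (\<i> * of_int n))"
          by (rule dist_triangle)
        finally show ?thesis
          using that(1) by (simp add: dist_norm norm_minus_commute)
      qed
      from resolvent_series[OF a open_ball _ this] e(1)
      have "z \<in> local_resolvent_set (Lp p) (Lp_norm p) Te (trig_class a)"
        unfolding local_resolvent_set_def by (force intro!: exI[of _ "ball z (e / 2)"])
      then show False using z by (simp add: local_spectrum_def)
    qed
  qed
qed (rule spectrum_subset_local_spectrum[OF a])

text \<open>
  From below, a single coefficient gives \<open>|P(in)|\<^sup>k |a\<^sub>n| \<le> \<parallel>Te\<^sup>k f\<parallel>\<close>, which also covers an infinite
  supremum. From above, a finite supremum \<open>\<rho>\<close> gives \<open>\<parallel>Te\<^sup>k f\<parallel> \<le> \<rho>\<^sup>k \<Sum> |a\<^sub>n|\<close>.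
\<close>

lemma root_Lp_norm_op_power_tendsto:
  assumes a: "rapidly_decreasing a"
  shows "(\<lambda>k. ennreal (root k (Lp_norm p (the (op_power Te k (trig_class a))))))
    \<longlonglongrightarrow> (SUP n\<in>{n. a n \<noteq> 0}. ennreal (norm (poly P (\<i> * of_int n))))"
    (is "?f \<longlonglongrightarrow> ?R")
proof -
  define q where "q n = poly P (\<i> * of_int n)" for n
  define N where "N k = Lp_norm p (trig_class (\<lambda>n. q n ^ k * a n))" for k
  have f: "?f = (\<lambda>k. ennreal (root k (N k)))"
    using op_power_trig_class[OF a] by (simp add: N_def q_def)
  have r: "rapidly_decreasing (\<lambda>n. q n ^ k * a n)" for k
    using op_power_trig_class[OF a] by (simp add: q_def)
  show ?thesis
    unfolding f
  proof (rule order_tendstoI)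
    fix y
    assume "y < ?R"
    then obtain n where n: "a n \<noteq> 0" "y < ennreal (norm (q n))"
      by (auto simp: less_SUP_iff q_def)
    have "(\<lambda>k. norm (q n) * root k (norm (a n))) \<longlonglongrightarrow> norm (q n) * 1"
      using n(1) by (intro tendsto_intros LIMSEQ_root_const) auto
    then have "(\<lambda>k. ennreal (norm (q n) * root k (norm (a n)))) \<longlonglongrightarrow> ennreal (norm (q n))"
      by (intro tendsto_ennrealI) simp
    then have "\<forall>\<^sub>F k in sequentially. y < ennreal (norm (q n) * root k (norm (a n)))"
      using n(2) by (rule order_tendstoD)
    then show "\<forall>\<^sub>F k in sequentially. y < ennreal (root k (N k))"
      using eventually_gt_at_top[of 0]
    proof eventually_elim
      case (elim k)
      have "norm (q n) ^ k * norm (a n) \<le> N k"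
        using norm_fourier_coeff_le_Lp_norm[OF p trig_class_Lp(1)[OF p r[of k]], of n]
        by (simp add: N_def fourier_coeff_trig_class r norm_mult norm_power)
      then have "root k (norm (q n) ^ k * norm (a n)) \<le> root k (N k)"
        using elim(2) by simp
      then have "norm (q n) * root k (norm (a n)) \<le> root k (N k)"
        using elim(2) by (simp add: real_root_mult real_root_power_cancel)
      then show ?case
        using elim(1) by (meson ennreal_leI less_le_trans)
    qed
  next
    fix y
    assume "?R < y"
    then obtain \<rho> where \<rho>: "?R = ennreal \<rho>" "0 \<le> \<rho>"
      by (cases ?R) (auto simp: top_unique)
    have le: "norm (q n) \<le> \<rho>" if "a n \<noteq> 0" for n
    proof -
      have "ennreal (norm (q n)) \<le> ?R"
        unfolding q_def using that by (intro SUP_upper) simp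
      then show ?thesis using \<rho> by simp
    qed
    \<comment> \<open>the summand \<open>1\<close> keeps \<open>M\<close> positive when \<open>a = 0\<close>, so that its roots tend to \<open>1\<close>\<close>
    define M where "M = (\<Sum>k. norm (a (int_decode k))) + 1"
    have "M > 0"
      unfolding M_def by (intro add_nonneg_pos suminf_nonneg rapidly_decreasing_summable a) auto
    have "(\<lambda>k. \<rho> * root k M) \<longlonglongrightarrow> \<rho> * 1"
      using \<open>M > 0\<close> by (intro tendsto_intros LIMSEQ_root_const)
    then have "(\<lambda>k. ennreal (\<rho> * root k M)) \<longlonglongrightarrow> ennreal \<rho>"
      by (intro tendsto_ennrealI) simp
    then have "\<forall>\<^sub>F k in sequentially. ennreal (\<rho> * root k M) < y"
      using \<open>?R < y\<close> unfolding \<rho>(1) by (rule order_tendstoD)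
    then show "\<forall>\<^sub>F k in sequentially. ennreal (root k (N k)) < y"
      using eventually_gt_at_top[of 0]
    proof eventually_elim
      case (elim k)
      have "norm (q n ^ k * a n) \<le> \<rho> ^ k * norm (a n)" for n
        using le[of n] by (cases "a n = 0") (auto simp: norm_mult norm_power mult_right_mono power_mono)
      from Lp_norm_trig_class_le[OF p a this]
      have "N k \<le> \<rho> ^ k * (M - 1)"
        by (simp add: N_def M_def)
      also have "\<dots> \<le> \<rho> ^ k * M"
        using \<rho>(2) by (intro mult_left_mono) auto
      finally have "root k (N k) \<le> root k (\<rho> ^ k * M)"
        using elim(2) by simp
      then have "root k (N k) \<le> \<rho> * root k M"
        using elim(2) \<rho>(2) by (simp add: real_root_mult real_root_power_cancel)
      then show ?case
        using elim(1) by (meson ennreal_leI le_less_trans)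
    qed
  qed
qed

end

section \<open>The local spectral radius formula\<close>

lemma SUP_norm_closure:
  fixes S :: "complex set"
  shows "(SUP z\<in>closure S. ennreal (norm z)) = (SUP z\<in>S. ennreal (norm z))"
proof (rule antisym)
  let ?C = "{z. ennreal (norm z) \<le> (SUP z\<in>S. ennreal (norm z))}"
  have "closed ?C"
    by (intro closed_Collect_le continuous_on_ennreal continuous_intros)
  moreover have "S \<subseteq> ?C"
    by (auto intro: SUP_upper)
  ultimately have "closure S \<subseteq> ?C" by (rule closure_minimal[rotated])
  then show "(SUP z\<in>closure S. ennreal (norm z)) \<le> (SUP z\<in>S. ennreal (norm z))"
    by (auto intro: SUP_least)
qed (intro SUP_subset_mono closure_subset order_refl)

theorem theorem3p1:
  fixes p :: ereal and P :: "complex poly" and Te :: "circle_fun \<rightharpoonup> circle_fun"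
  assumes "1 \<le> p"
    and "linear_operator (Lp p) Te"
    and "T_op P \<subseteq>\<^sub>m Te" and "Te \<subseteq>\<^sub>m Tc_op p P"
  shows "has_SVEP (Lp p) (Lp_norm p) Te \<and>
    (\<forall>f\<in>smooth_circle.
       (\<forall>n. abs_circle_fun f \<in> dom (op_power Te n)) \<and>
       (\<lambda>n. ennreal (root n (Lp_norm p (the (op_power Te n (abs_circle_fun f))))))
         \<longlonglongrightarrow> (SUP z\<in>closure {poly P (\<i> * of_int n) |n. fourier_coeff f n \<noteq> 0}. ennreal (norm z)) \<and>
       local_spectrum (Lp p) (Lp_norm p) Te (abs_circle_fun f)
         = closure {poly P (\<i> * of_int n) |n. fourier_coeff f n \<noteq> 0} \<and>
       (\<lambda>n. ennreal (root n (Lp_norm p (the (op_power Te n (abs_circle_fun f))))))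
         \<longlonglongrightarrow> (SUP z\<in>local_spectrum (Lp p) (Lp_norm p) Te (abs_circle_fun f). ennreal (norm z)))"
proof -
  interpret differential_operator_extension p P Te
    by unfold_locales (fact assms)+
  show ?thesis
  proof (intro conjI ballI SVEP)
    fix f
    assume f: "f \<in> smooth_circle"
    let ?S = "{poly P (\<i> * of_int n) |n. fourier_coeff f n \<noteq> 0}"
    note a = rapidly_decreasing_fourier_coeff[OF f]
    note F = trig_class_fourier_coeff[OF f]
    show dom: "\<forall>n. abs_circle_fun f \<in> dom (op_power Te n)"
      using op_power_trig_class[OF a] by (simp add: F domIff)
    show spec: "local_spectrum (Lp p) (Lp_norm p) Te (abs_circle_fun f) = closure ?S"
      using local_spectrum_trig_class[OF a] by (simp add: F)
    have "?S = (\<lambda>n. poly P (\<i> * of_int n)) ` {n. fourier_coeff f n \<noteq> 0}"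
      by auto
    then have "(SUP z\<in>closure ?S. ennreal (norm z))
        = (SUP n\<in>{n. fourier_coeff f n \<noteq> 0}. ennreal (norm (poly P (\<i> * of_int n))))"
      by (simp only: SUP_norm_closure image_image)
    with root_Lp_norm_op_power_tendsto[OF a]
    show lim: "(\<lambda>n. ennreal (root n (Lp_norm p (the (op_power Te n (abs_circle_fun f))))))
         \<longlonglongrightarrow> (SUP z\<in>closure ?S. ennreal (norm z))"
      by (simp only: F)
    then show "(\<lambda>n. ennreal (root n (Lp_norm p (the (op_power Te n (abs_circle_fun f))))))
         \<longlonglongrightarrow> (SUP z\<in>local_spectrum (Lp p) (Lp_norm p) Te (abs_circle_fun f). ennreal (norm z))"
      by (simp only: spec)
  qed
qed

end
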